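(* Suppose that $c(\cdot)$ is $L_c$-Lipschitz on $S$, i.e. $\|c(w_1)-c(w_2)\|_2\le L_c\|w_1-w_2\|$ for all $w_1,w_2\in S$, that $\phi$ is 1-strongly convex on the compact set $S$, and that the hypothesis class $\mathcal{H}$ has bounded multivariate Rademacher complexity $\mathfrak{R}_n(\mathcal{H})$. Then, for any $\delta\in(0,1]$ and $\rho_n>0$, with probability at least $1-\delta$ over i.i.d. data $\{(x_i,\xi_i)\}_{i=1}^n$ drawn from $\mathcal{D}$, the following inequality holds for all $f\in\mathcal{H}$: $$R(w_{\rho_n}\circ f)\ \le\ \hat R_n(w_{\rho_n}\circ f)+\frac{\sqrt2\,L_c^2}{\rho_n}\,\mathfrak{R}_n(\mathcal{H})+\bar c\,\sqrt{\frac{\log(1/\delta)}{2n}} .$$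
   Context: Setting. $S\subset\mathbb{R}^d$ is a nonempty convex compact set and $\|\cdot\|$ is a norm on $\mathbb{R}^d$. The feature vector $x$ takes values in $\mathcal{X}\subseteq\mathbb{R}^p$; the random parameter $\xi$ takes values in a finite set $\Xi=\{\tilde z_1,\dots,\tilde z_K\}$; $\mathcal{D}$ is the joint distribution of $(x,\xi)$ and $\mathcal{D}_x$ the marginal of $x$. $c:S\times\Xi\to\mathbb{R}$ is such that each $c_k(\cdot):=c(\cdot,\tilde z_k)$ is convex on $S$; with abuse of notation $c(\cdot):S\to\mathbb{R}^K$ also denotes the vector-valued map $w\mapsto(c_1(w),\dots,c_K(w))$. $\bar c:=\sup_{w\in S,\xi\in\Xi}|c(w,\xi)|$. $\phi:S\to\mathbb{R}$ is non-negative and continuous; 1-strong convexity is with respect to $\|\cdot\|$. $\Delta_K:=\{p\in\mathbb{R}^K:\sum_kp_k=1,\ p\ge0\}$. For $p\in\Delta_K$, $\rho>0$, $w_\rho(p):=\arg\min_{w\in S}\{\sum_{k=1}^Kp_kc_k(w)+\rho\phi(w)\}$, which is a single point. $\mathcal{H}$ is a class of functions $f:\mathcal{X}\to\Delta_K$. Risks: for $\pi:\mathcal{X}\to S$, $R(\pi):=\mathbb{E}_{(x,\xi)\sim\mathcal{D}}[c(\pi(x),\xi)]$ and $\hat R_n(\pi):=\frac1n\sum_{i=1}^nc(\pi(x_i),\xi_i)$. Multivariate Rademacher complexity: $\hat{\mathfrak{R}}_n(\mathcal{H}):=\mathbb{E}_\sigma\big[\frac2n\sup_{f\in\mathcal{H}}\sum_{i=1}^n\sum_{k=1}^K\sigma_{ik}f_k(x_i)\big]$,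 where $\sigma_{ik}$ are independent with $\Pr(\sigma_{ik}=\pm1)=\frac12$, and $\mathfrak{R}_n(\mathcal{H}):=\mathbb{E}[\hat{\mathfrak{R}}_n(\mathcal{H})]$, the expectation being over $x_1,\dots,x_n$ i.i.d. from $\mathcal{D}_x$.
   Formalization: Assumes c ≥ 0 on S (for signed c the bound fails: S one point, costs 1 and −1 equally likely, n=1, δ=1/4), and that every f in H is Borel and a pointwise limit of a sequence from one countable subclass of H, so that the suprema are measurable. *)

theory Defs
  imports "HOL-Probability.Probability"
begin

definition is_norm :: "('v::real_vector \<Rightarrow> real) \<Rightarrow> bool" where
  "is_norm N \<longleftrightarrow>
     (\<forall>x. 0 \<le> N x) \<and> (\<forall>x. N x = 0 \<longleftrightarrow> x = 0) \<and>
     (\<forall>a x. N (a *\<^sub>R x) = \<bar>a\<bar> * N x) \<and> (\<forall>x y. N (x + y) \<le> N x + N y)"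

definition strongly_convex_wrt ::
  "('v::real_vector \<Rightarrow> real) \<Rightarrow> real \<Rightarrow> 'v set \<Rightarrow> ('v \<Rightarrow> real) \<Rightarrow> bool" where
  "strongly_convex_wrt N m S \<phi> \<longleftrightarrow>
     (\<forall>v\<in>S. \<forall>w\<in>S. \<forall>t\<in>{0..1}.
        \<phi> (t *\<^sub>R v + (1 - t) *\<^sub>R w)
          \<le> t * \<phi> v + (1 - t) * \<phi> w - m / 2 * t * (1 - t) * (N (v - w))\<^sup>2)"

definition prob_simplex :: "(real ^ 'k) set" where
  "prob_simplex = {p. (\<Sum>k\<in>UNIV. p $ k) = 1 \<and> (\<forall>k. 0 \<le> p $ k)}"

text \<open>The scenarios are enumerated by \<^term>\<open>z :: 'k \<Rightarrow> 'z\<close>; their finite set is \<^term>\<open>range z\<close>.\<close>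

definition cost_vec :: "('v \<Rightarrow> 'z \<Rightarrow> real) \<Rightarrow> ('k \<Rightarrow> 'z) \<Rightarrow> 'v \<Rightarrow> real ^ 'k" where
  "cost_vec c z w = (\<chi> k. c w (z k))"

text \<open>Bounds the magnitude of the cost. It also bounds the oscillation, which is what a bounded
  difference inequality uses, when the cost is nonnegative; for signed costs the oscillation can be
  twice as large.\<close>

definition cost_bound :: "'v set \<Rightarrow> 'z set \<Rightarrow> ('v \<Rightarrow> 'z \<Rightarrow> real) \<Rightarrow> real" where
  "cost_bound S \<Xi> c = (SUP (w, \<xi>)\<in>S \<times> \<Xi>. \<bar>c w \<xi>\<bar>)"

text \<open>Only used where the minimizer is unique, so that the choice made by
  \<^const>\<open>arg_min_on\<close> is immaterial.\<close>

definition w_opt ::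
  "'v set \<Rightarrow> ('v \<Rightarrow> 'z \<Rightarrow> real) \<Rightarrow> ('k::finite \<Rightarrow> 'z) \<Rightarrow> ('v \<Rightarrow> real) \<Rightarrow> real \<Rightarrow> real ^ 'k \<Rightarrow> 'v" where
  "w_opt S c z \<phi> \<rho> p = arg_min_on (\<lambda>w. (\<Sum>k\<in>UNIV. p $ k * cost_vec c z w $ k) + \<rho> * \<phi> w) S"

definition risk :: "('x \<times> 'z) measure \<Rightarrow> ('v \<Rightarrow> 'z \<Rightarrow> real) \<Rightarrow> ('x \<Rightarrow> 'v) \<Rightarrow> real" where
  "risk D c \<pi> = (\<integral>(x, \<xi>). c (\<pi> x) \<xi> \<partial>D)"

definition empirical_risk ::
  "nat \<Rightarrow> (nat \<Rightarrow> 'x \<times> 'z) \<Rightarrow> ('v \<Rightarrow> 'z \<Rightarrow> real) \<Rightarrow> ('x \<Rightarrow> 'v) \<Rightarrow> real" where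
  "empirical_risk n s c \<pi> = 1 / real n * (\<Sum>i<n. c (\<pi> (fst (s i))) (snd (s i)))"

definition rademacher_signs :: "nat \<Rightarrow> (nat \<times> 'k::finite \<Rightarrow> real) pmf" where
  "rademacher_signs n = Pi_pmf ({..<n} \<times> UNIV) 0 (\<lambda>_. pmf_of_set {-1, 1})"

definition empirical_rademacher ::
  "nat \<Rightarrow> ('x \<Rightarrow> real ^ 'k::finite) set \<Rightarrow> (nat \<Rightarrow> 'x) \<Rightarrow> real" where
  "empirical_rademacher n H x =
     measure_pmf.expectation (rademacher_signs n)
       (\<lambda>\<sigma>. 2 / real n * (SUP f\<in>H. \<Sum>i<n. \<Sum>k\<in>UNIV. \<sigma> (i, k) * f (x i) $ k))"

definition iid :: "nat \<Rightarrow> 'a measure \<Rightarrow> (nat \<Rightarrow> 'a) measure" where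
  "iid n M = (\<Pi>\<^sub>M i\<in>{..<n}. M)"

definition rademacher :: "'x measure \<Rightarrow> nat \<Rightarrow> ('x \<Rightarrow> real ^ 'k::finite) set \<Rightarrow> real" where
  "rademacher Dx n H = (\<integral>x. empirical_rademacher n H x \<partial>iid n Dx)"

text \<open>Finiteness of the expectation defining \<^const>\<open>rademacher\<close>; without it the Bochner integral
  would be the dummy value 0.\<close>

definition bounded_rademacher :: "'x measure \<Rightarrow> nat \<Rightarrow> ('x \<Rightarrow> real ^ 'k::finite) set \<Rightarrow> bool" where
  "bounded_rademacher Dx n H \<longleftrightarrow> integrable (iid n Dx) (empirical_rademacher n H)"

text \<open>The usual regularity condition making suprema over an uncountable class measurable. It cannot
  simply be dropped in uniform deviation bounds: under the continuum hypothesis, the indicators of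
  the countable initial segments of a well-ordering of the unit interval of type \<open>\<omega>\<^sub>1\<close> shatter no
  two-point set, yet on every sample some
  empirical mean deviates from its expectation by 1.\<close>

definition pointwise_measurable_class ::
  "'x measure \<Rightarrow> ('x \<Rightarrow> 'y::topological_space) set \<Rightarrow> bool" where
  "pointwise_measurable_class M H \<longleftrightarrow>
     H \<subseteq> borel_measurable M \<and>
     (\<exists>H\<^sub>0\<subseteq>H. countable H\<^sub>0 \<and>
        (\<forall>f\<in>H. \<exists>g. range g \<subseteq> H\<^sub>0 \<and> (\<forall>x\<in>space M. (\<lambda>j. g j x) \<longlonglongrightarrow> f x)))"

end

theory Submission
  imports Defs
begin

text \<open>
  By strong convexity the regularized minimizer depends on the weight vector in a Lipschitz way, with
  constant \<open>L\<^sub>c / \<rho>\<close>, so every composed loss \<open>c\<^sub>k \<circ> w\<^sub>\<rho>\<close> is Lipschitz on the simplex with constant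
  \<open>L\<^sub>c\<^sup>2 / \<rho>\<close>. McDiarmid's inequality concentrates the largest deviation of an empirical risk from the
  risk around its mean. That mean is bounded one sample at a time: each sample is symmetrized and its
  loss replaced by the coordinates of the hypothesis at once, by Maurer's vector contraction
  principle, whose factor \<open>sqrt 2\<close> is Khintchine's constant for the mean absolute value of a
  Rademacher sum. All suprema are taken over a countable pointwise dense subclass.
\<close>

section \<open>Rademacher signs and Khintchine's inequality\<close>

text \<open>The \<open>sqrt 2\<close> of the claim is the sharp L1 Khintchine constant, so a cheaper
  route such as the fourth-moment bound, which gives \<open>sqrt 3\<close>, would not do; hence the
  spectral argument on the sign cube. \<open>L\<^sub>c\<close> enters squared because the cost
  vector acts twice: as linear coefficient of the objective it governs how far the minimizer moves,
  and the cost is then evaluated at the moved point. The \<open>2\<close> of symmetrization is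
  absorbed by the \<open>2 / real n\<close> in \<open>empirical_rademacher\<close>. When one sample
  is exchanged, the supremum still couples it to all the others. Their contribution is therefore
  kept in an arbitrary bounded offset \<open>a f\<close>, and each step is proved for every such
  offset; this makes the induction on the sample size possible. Measurability is the other obstacle:
  \<open>w_opt\<close> is a choice function and \<open>H\<close> may be uncountable. Only the
  composed costs, which are continuous on the simplex, are measured, and that continuity also
  carries the bound from the countable subclass back to \<open>H\<close>.\<close>

definition sign_pmf :: "'i set \<Rightarrow> ('i \<Rightarrow> real) pmf" where
  "sign_pmf A = Pi_pmf A 0 (\<lambda>_. pmf_of_set {-1, 1})"

abbreviation sign_mean :: "'i set \<Rightarrow> (('i \<Rightarrow> real) \<Rightarrow> real) \<Rightarrow> real" where
  "sign_mean A h \<equiv> measure_pmf.expectation (sign_pmf A) h"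

lemma finite_set_sign_pmf [simp]: "finite A \<Longrightarrow> finite (set_pmf (sign_pmf A))"
  by (auto simp: sign_pmf_def set_Pi_pmf intro!: finite_PiE_dflt)

lemma integrable_sign_pmf [simp]:
  fixes h :: "('i \<Rightarrow> real) \<Rightarrow> real"
  shows "finite A \<Longrightarrow> integrable (sign_pmf A) h"
  by (simp add: integrable_measure_pmf_finite)

lemma sign_pmf_values: "finite A \<Longrightarrow> \<sigma> \<in> set_pmf (sign_pmf A) \<Longrightarrow> k \<in> A \<Longrightarrow> \<sigma> k = -1 \<or> \<sigma> k = 1"
  by (auto simp: sign_pmf_def set_Pi_pmf PiE_dflt_def)

lemma sign_mean_mono:
  assumes "finite A" "\<And>\<sigma>. \<sigma> \<in> set_pmf (sign_pmf A) \<Longrightarrow> h \<sigma> \<le> g \<sigma>"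
  shows "sign_mean A h \<le> sign_mean A g"
  using assms by (intro integral_mono_AE) (auto simp: AE_measure_pmf_iff)

lemma sign_mean_empty: "sign_mean {} h = h (\<lambda>_. 0)"
  by (simp add: sign_pmf_def)

text \<open>Conditioning on the sign at \<open>x\<close> is the induction step for most facts about
  signs. \<open>sign_pmf\<close> takes an arbitrary index set, unlike
  \<open>rademacher_signs\<close>, to make such inductions possible.\<close>

lemma sign_mean_insert:
  assumes "finite A" "x \<notin> A"
  shows "sign_mean (insert x A) h =
    (sign_mean A (\<lambda>\<sigma>. h (\<sigma>(x := 1))) + sign_mean A (\<lambda>\<sigma>. h (\<sigma>(x := - 1)))) / 2"
proof -
  have "sign_pmf (insert x A) =
      pmf_of_set {-1, 1} \<bind> (\<lambda>y. map_pmf (\<lambda>f. f(x := y)) (sign_pmf A))"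
    unfolding sign_pmf_def by (simp add: Pi_pmf_insert'[OF assms] map_pmf_def)
  then have "sign_mean (insert x A) h =
      measure_pmf.expectation (pmf_of_set {-1, 1::real}) (\<lambda>y. sign_mean A (\<lambda>\<sigma>. h (\<sigma>(x := y))))"
    using assms by (simp add: pmf_expectation_bind[where A = "{-1,1}"] integral_pmf_of_set)
  then show ?thesis by (simp add: integral_pmf_of_set)
qed

text \<open>Each sign is symmetric, and the default value 0 outside \<open>A\<close> is its own
  negative, so negating the whole function preserves its law.\<close>

lemma sign_mean_uminus:
  assumes "finite A"
  shows "sign_mean A (\<lambda>\<sigma>. h (\<lambda>k. - \<sigma> k)) = sign_mean A h"
  using assms
proof (induction A arbitrary: h rule: finite_induct)
  case empty
  then show ?case by (simp add: sign_mean_empty)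
next
  case (insert x A)
  have upd: "(\<lambda>k. - (\<sigma>(x := y)) k) = (\<lambda>k. - \<sigma> k)(x := - y)" for \<sigma> and y :: real by auto
  show ?case
    using insert.IH[of "\<lambda>\<sigma>. h (\<sigma>(x := 1))"] insert.IH[of "\<lambda>\<sigma>. h (\<sigma>(x := -1))"]
    by (simp add: sign_mean_insert insert.hyps upd del: fun_upd_apply)
qed

text \<open>Flipping only swaps the two halves into which \<open>sign_mean_insert\<close> splits the
  mean at \<open>k\<close>.\<close>

lemma sign_mean_flip:
  assumes "finite A" "k \<in> A"
  shows "sign_mean A (\<lambda>\<sigma>. h (\<sigma>(k := - \<sigma> k))) = sign_mean A h"
proof -
  have "finite (A - {k})" "k \<notin> A - {k}" "insert k (A - {k}) = A" using assms by auto
  then show ?thesis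
    using sign_mean_insert[of "A - {k}" k "\<lambda>\<sigma>. h (\<sigma>(k := - \<sigma> k))"] sign_mean_insert[of "A - {k}" k h]
    by simp
qed

lemma sign_mean_square_ge:
  assumes "finite A"
  shows "(sign_mean A h)\<^sup>2 \<le> sign_mean A (\<lambda>\<sigma>. (h \<sigma>)\<^sup>2)"
proof -
  let ?m = "sign_mean A h"
  have "0 \<le> sign_mean A (\<lambda>\<sigma>. (h \<sigma> - ?m)\<^sup>2)" by simp
  also have "\<dots> = sign_mean A (\<lambda>\<sigma>. (h \<sigma>)\<^sup>2 - 2 * ?m * h \<sigma> + ?m\<^sup>2)"
    by (simp add: power2_diff algebra_simps)
  also have "\<dots> = sign_mean A (\<lambda>\<sigma>. (h \<sigma>)\<^sup>2) - ?m\<^sup>2"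
    using assms by (simp add: power2_eq_square)
  finally show ?thesis by simp
qed

text \<open>In Fourier terms, a character of degree \<open>j\<close> contributes \<open>4 * j\<close> on the right-hand side,
  and on the left-hand side \<open>8\<close> if \<open>j > 0\<close> is even, \<open>4\<close> if \<open>j\<close> is odd, and \<open>0\<close> if \<open>j = 0\<close>.
  On even functions this is the doubled spectral gap that gives Khintchine's constant.\<close>

lemma hypercube_poincare:
  assumes "finite A"
  shows "6 * sign_mean A (\<lambda>\<sigma>. (h \<sigma>)\<^sup>2) + 2 * sign_mean A (\<lambda>\<sigma>. h \<sigma> * h (\<lambda>k. - \<sigma> k))
      - 8 * (sign_mean A h)\<^sup>2
    \<le> (\<Sum>k\<in>A. sign_mean A (\<lambda>\<sigma>. (h \<sigma> - h (\<sigma>(k := - \<sigma> k)))\<^sup>2))"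
  using assms
proof (induction A arbitrary: h rule: finite_induct)
  case empty
  then show ?case by (simp add: sign_mean_empty power2_eq_square)
next
  case (insert x A)
  note [simp] = insert.hyps
  let ?E = "sign_mean A"
  define Dir where "Dir g = (\<Sum>k\<in>A. ?E (\<lambda>\<sigma>. (g \<sigma> - g (\<sigma>(k := - \<sigma> k)))\<^sup>2))" for g
  \<comment> \<open>Even and odd parts in the coordinate \<open>x\<close>: on the cube,
    \<open>h\<close> is \<open>u\<close> plus the sign at \<open>x\<close> times
    \<open>w\<close>.\<close>
  define u where "u \<sigma> = (h (\<sigma>(x := 1)) + h (\<sigma>(x := -1))) / 2" for \<sigma>
  define w where "w \<sigma> = (h (\<sigma>(x := 1)) - h (\<sigma>(x := -1))) / 2" for \<sigma>
  have P: "h (\<sigma>(x := 1)) = u \<sigma> + w \<sigma>" and M: "h (\<sigma>(x := -1)) = u \<sigma> - w \<sigma>" for \<sigma>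
    by (simp_all add: u_def w_def field_simps)
  have upd: "(\<lambda>k. - (\<sigma>(x := y)) k) = (\<lambda>k. - \<sigma> k)(x := - y)" for \<sigma> and y :: real by auto
  have E: "sign_mean (insert x A) h = ?E u"
    by (simp add: sign_mean_insert P M)
  have E2: "sign_mean (insert x A) (\<lambda>\<sigma>. (h \<sigma>)\<^sup>2) = ?E (\<lambda>\<sigma>. (u \<sigma>)\<^sup>2) + ?E (\<lambda>\<sigma>. (w \<sigma>)\<^sup>2)"
    by (simp add: sign_mean_insert P M power2_sum power2_diff)
  \<comment> \<open>Negating all signs also negates the one at \<open>x\<close>, hence the minus
    sign before the \<open>w\<close> term.\<close>
  have En: "sign_mean (insert x A) (\<lambda>\<sigma>. h \<sigma> * h (\<lambda>k. - \<sigma> k))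
      = ?E (\<lambda>\<sigma>. u \<sigma> * u (\<lambda>k. - \<sigma> k)) - ?E (\<lambda>\<sigma>. w \<sigma> * w (\<lambda>k. - \<sigma> k))"
    by (simp add: sign_mean_insert upd P M del: fun_upd_apply) (simp add: algebra_simps)
  have Dx: "sign_mean (insert x A) (\<lambda>\<sigma>. (h \<sigma> - h (\<sigma>(x := - \<sigma> x)))\<^sup>2) = 4 * ?E (\<lambda>\<sigma>. (w \<sigma>)\<^sup>2)"
  proof -
    have "(u \<sigma> + w \<sigma> - (u \<sigma> - w \<sigma>))\<^sup>2 = 4 * (w \<sigma>)\<^sup>2"
      "(u \<sigma> - w \<sigma> - (u \<sigma> + w \<sigma>))\<^sup>2 = 4 * (w \<sigma>)\<^sup>2" for \<sigma>
      by (simp_all add: power2_eq_square)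
    then show ?thesis by (simp add: sign_mean_insert P M)
  qed
  have DA: "(\<Sum>k\<in>A. sign_mean (insert x A) (\<lambda>\<sigma>. (h \<sigma> - h (\<sigma>(k := - \<sigma> k)))\<^sup>2)) = Dir u + Dir w"
  proof -
    have "sign_mean (insert x A) (\<lambda>\<sigma>. (h \<sigma> - h (\<sigma>(k := - \<sigma> k)))\<^sup>2)
      = ?E (\<lambda>\<sigma>. (u \<sigma> - u (\<sigma>(k := - \<sigma> k)))\<^sup>2) + ?E (\<lambda>\<sigma>. (w \<sigma> - w (\<sigma>(k := - \<sigma> k)))\<^sup>2)"
      if "k \<in> A" for k
    proof -
      have [simp]: "k \<noteq> x" "x \<noteq> k" using that insert.hyps(2) by blast+
      have tw: "\<sigma>(x := y, k := - \<sigma> k) = \<sigma>(k := - \<sigma> k, x := y)" for \<sigma> and y :: real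
        by (simp add: fun_upd_twist)
      have "((u s + w s - (u t + w t))\<^sup>2 + (u s - w s - (u t - w t))\<^sup>2) / 2
          = (u s - u t)\<^sup>2 + (w s - w t)\<^sup>2" for s t
        by (simp add: power2_eq_square field_simps)
      note eq = this
      have "sign_mean (insert x A) (\<lambda>\<sigma>. (h \<sigma> - h (\<sigma>(k := - \<sigma> k)))\<^sup>2)
        = ?E (\<lambda>\<sigma>. ((u \<sigma> + w \<sigma> - (u (\<sigma>(k := - \<sigma> k)) + w (\<sigma>(k := - \<sigma> k))))\<^sup>2
           + (u \<sigma> - w \<sigma> - (u (\<sigma>(k := - \<sigma> k)) - w (\<sigma>(k := - \<sigma> k))))\<^sup>2) / 2)"
        by (simp add: sign_mean_insert tw P M)
      then show ?thesis unfolding eq by simp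
    qed
    then show ?thesis by (simp add: Dir_def sum.distrib)
  qed
  have IHu: "6 * ?E (\<lambda>\<sigma>. (u \<sigma>)\<^sup>2) + 2 * ?E (\<lambda>\<sigma>. u \<sigma> * u (\<lambda>k. - \<sigma> k)) - 8 * (?E u)\<^sup>2 \<le> Dir u"
    unfolding Dir_def by (rule insert.IH)
  have IHw: "6 * ?E (\<lambda>\<sigma>. (w \<sigma>)\<^sup>2) + 2 * ?E (\<lambda>\<sigma>. w \<sigma> * w (\<lambda>k. - \<sigma> k)) - 8 * (?E w)\<^sup>2 \<le> Dir w"
    unfolding Dir_def by (rule insert.IH)
  \<comment> \<open>The squared mean of \<open>w\<close> occurs in \<open>IHw\<close> but not in the
    goal, since the mean of \<open>h\<close> only sees \<open>u\<close>. Jensen for the sum of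
    \<open>w\<close> and its reflection trades it for second moments.\<close>
  have Ew: "4 * (?E w)\<^sup>2 \<le> 2 * ?E (\<lambda>\<sigma>. (w \<sigma>)\<^sup>2) + 2 * ?E (\<lambda>\<sigma>. w \<sigma> * w (\<lambda>k. - \<sigma> k))"
    using sign_mean_square_ge[OF insert.hyps(1), of "\<lambda>\<sigma>. w \<sigma> + w (\<lambda>k. - \<sigma> k)"]
      sign_mean_uminus[OF insert.hyps(1), of w] sign_mean_uminus[OF insert.hyps(1), of "\<lambda>\<sigma>. (w \<sigma>)\<^sup>2"]
    by (simp add: power2_sum mult.assoc)
  show ?case
  proof -
    let ?w = "?E (\<lambda>\<sigma>. (w \<sigma>)\<^sup>2)" and ?n = "?E (\<lambda>\<sigma>. w \<sigma> * w (\<lambda>k. - \<sigma> k))"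
    \<comment> \<open>The \<open>u\<close> part of the goal is \<open>IHu\<close>. For
      \<open>w\<close>, once \<open>Dx\<close> has contributed \<open>4 * ?w\<close>, exactly
      \<open>2 * ?w - 2 * ?n \<le> Dir w\<close> remains.\<close>
    have "8 * (?E w)\<^sup>2 \<le> 4 * ?w + 4 * ?n" using Ew by simp
    then have "2 * ?w - 2 * ?n \<le> Dir w" using IHw by simp
    then show ?thesis unfolding sum.insert[OF insert.hyps] E E2 En Dx DA using IHu by simp
  qed
qed

text \<open>Distinct signs are orthogonal; in the induction the cross terms cancel between the
  values 1 and -1 at \<open>x\<close>.\<close>

lemma sign_mean_linear_square:
  assumes "finite A"
  shows "sign_mean A (\<lambda>\<sigma>. (\<Sum>k\<in>A. \<sigma> k * v k)\<^sup>2) = (\<Sum>k\<in>A. (v k)\<^sup>2)"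
  using assms
proof (induction A rule: finite_induct)
  case empty
  then show ?case by (simp add: sign_mean_empty)
next
  case (insert x A)
  have *: "(\<Sum>k\<in>A. (\<sigma>(x := y)) k * v k) = (\<Sum>k\<in>A. \<sigma> k * v k)" for \<sigma> and y :: real
    using insert.hyps by (intro sum.cong) auto
  have "sign_mean (insert x A) (\<lambda>\<sigma>. (\<Sum>k\<in>insert x A. \<sigma> k * v k)\<^sup>2)
    = (v x)\<^sup>2 + sign_mean A (\<lambda>\<sigma>. (\<Sum>k\<in>A. \<sigma> k * v k)\<^sup>2)"
    using insert.hyps by (simp add: sign_mean_insert * del: fun_upd_apply)
      (simp add: power2_sum power2_diff)
  then show ?case using insert by simp
qed

text \<open>The argument of Latala and Oleszkiewicz: the absolute value \<open>h\<close> of a linear form is even and,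
  by the triangle inequality, the sum of \<open>h\<close> over the neighbours of a vertex is at least
  \<open>(card A - 2) * h\<close>.\<close>

lemma khintchine:
  assumes A: "finite A"
  shows "sqrt (\<Sum>k\<in>A. (v k)\<^sup>2) \<le> sqrt 2 * sign_mean A (\<lambda>\<sigma>. \<bar>\<Sum>k\<in>A. \<sigma> k * v k\<bar>)"
proof -
  define h where "h \<sigma> = \<bar>\<Sum>k\<in>A. \<sigma> k * v k\<bar>" for \<sigma> :: "'a \<Rightarrow> real"
  let ?E = "sign_mean A" and ?K = "real (card A)"
  have even: "h (\<lambda>k. - \<sigma> k) = h \<sigma>" for \<sigma>
    by (simp add: h_def sum_negf)
  have nbr: "(?K - 2) * h \<sigma> \<le> (\<Sum>k\<in>A. h (\<sigma>(k := - \<sigma> k)))" for \<sigma>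
  proof -
    have flip: "(\<Sum>j\<in>A. (\<sigma>(k := - \<sigma> k)) j * v j) = (\<Sum>j\<in>A. \<sigma> j * v j) - 2 * (\<sigma> k * v k)" if "k \<in> A" for k
    proof -
      have "(\<Sum>j\<in>A. (\<sigma>(k := - \<sigma> k)) j * v j) = (\<Sum>j\<in>A. \<sigma> j * v j - (if j = k then 2 * (\<sigma> k * v k) else 0))"
        by (intro sum.cong) auto
      then show ?thesis using A that by (simp add: sum_subtractf)
    qed
    \<comment> \<open>Each flip subtracts twice one summand, so over all \<open>k\<close> the whole
      form is subtracted twice.\<close>
    have S: "(\<Sum>k\<in>A. (\<Sum>j\<in>A. \<sigma> j * v j) - 2 * (\<sigma> k * v k)) = (?K - 2) * (\<Sum>j\<in>A. \<sigma> j * v j)"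
      by (simp add: sum_subtractf sum_distrib_left algebra_simps)
    have "(?K - 2) * h \<sigma> \<le> \<bar>(?K - 2) * (\<Sum>j\<in>A. \<sigma> j * v j)\<bar>"
      by (simp add: h_def abs_mult mult_right_mono)
    also have "\<bar>(?K - 2) * (\<Sum>j\<in>A. \<sigma> j * v j)\<bar> \<le> (\<Sum>k\<in>A. \<bar>(\<Sum>j\<in>A. \<sigma> j * v j) - 2 * (\<sigma> k * v k)\<bar>)"
      unfolding S[symmetric] by (rule sum_abs)
    also have "\<dots> = (\<Sum>k\<in>A. h (\<sigma>(k := - \<sigma> k)))"
      by (intro sum.cong) (auto simp: h_def flip simp del: fun_upd_apply)
    finally show ?thesis .
  qed
  \<comment> \<open>Evenness merges the first two terms of \<open>hypercube_poincare\<close>,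
    leaving eight times the variance of \<open>h\<close>.\<close>
  have "8 * ?E (\<lambda>\<sigma>. (h \<sigma>)\<^sup>2) - 8 * (?E h)\<^sup>2 \<le> (\<Sum>k\<in>A. ?E (\<lambda>\<sigma>. (h \<sigma> - h (\<sigma>(k := - \<sigma> k)))\<^sup>2))"
    using hypercube_poincare[OF A, of h] by (simp add: even flip: power2_eq_square)
  also have "\<dots> = (\<Sum>k\<in>A. 2 * ?E (\<lambda>\<sigma>. (h \<sigma>)\<^sup>2) - 2 * ?E (\<lambda>\<sigma>. h \<sigma> * h (\<sigma>(k := - \<sigma> k))))"
    using A sign_mean_flip[OF A, of _ "\<lambda>\<sigma>. (h \<sigma>)\<^sup>2"]
    by (intro sum.cong refl) (simp add: power2_diff mult.assoc)
  also have "\<dots> = 2 * ?K * ?E (\<lambda>\<sigma>. (h \<sigma>)\<^sup>2) - 2 * ?E (\<lambda>\<sigma>. h \<sigma> * (\<Sum>k\<in>A. h (\<sigma>(k := - \<sigma> k))))"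
    using A by (simp add: sum_subtractf sum_distrib_left)
  also have "\<dots> \<le> 2 * ?K * ?E (\<lambda>\<sigma>. (h \<sigma>)\<^sup>2) - 2 * ?E (\<lambda>\<sigma>. h \<sigma> * ((?K - 2) * h \<sigma>))"
    using A nbr by (intro diff_left_mono mult_left_mono sign_mean_mono) (auto simp: h_def)
  also have "?E (\<lambda>\<sigma>. h \<sigma> * ((?K - 2) * h \<sigma>)) = (?K - 2) * ?E (\<lambda>\<sigma>. (h \<sigma>)\<^sup>2)"
  proof -
    have "h \<sigma> * ((?K - 2) * h \<sigma>) = (?K - 2) * (h \<sigma>)\<^sup>2" for \<sigma>
      by (simp add: power2_eq_square)
    then show ?thesis by (simp only: integral_mult_right_zero)
  qed
  \<comment> \<open>The cardinality cancels: the right-hand side is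
    \<open>2 * ?K - 2 * (?K - 2) = 4\<close> times the second moment.\<close>
  finally have "?E (\<lambda>\<sigma>. (h \<sigma>)\<^sup>2) \<le> 2 * (?E h)\<^sup>2" by (simp add: algebra_simps)
  moreover have "?E (\<lambda>\<sigma>. (h \<sigma>)\<^sup>2) = (\<Sum>k\<in>A. (v k)\<^sup>2)"
    by (simp add: h_def sign_mean_linear_square[OF A])
  moreover have "0 \<le> ?E h" by (simp add: h_def)
  ultimately have "sqrt (\<Sum>k\<in>A. (v k)\<^sup>2) \<le> sqrt 2 * ?E h"
    by (metis abs_of_nonneg real_sqrt_abs real_sqrt_le_mono real_sqrt_mult)
  then show ?thesis unfolding h_def .
qed

section \<open>Symmetrization and contraction\<close>

lemma sign_mean_times_singleton:
  fixes h :: "('i \<times> 'j \<Rightarrow> real) \<Rightarrow> real"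
  assumes "finite K"
  shows "sign_mean ({n} \<times> K) h = sign_mean K (\<lambda>\<tau>. h (\<lambda>(i, k). if i = n then \<tau> k else 0))"
  using assms
proof (induction K arbitrary: h rule: finite_induct)
  case empty
  have "(\<lambda>(i, k). if i = n then 0 else 0) = (\<lambda>_::'i \<times> 'j. 0::real)" by auto
  then show ?case by (simp add: sign_mean_empty)
next
  case (insert x K)
  have *: "{n} \<times> insert x K = insert (n, x) ({n} \<times> K)" "finite ({n} \<times> K)" "(n, x) \<notin> {n} \<times> K"
    using insert.hyps by auto
  have upd: "(\<lambda>(i, k). if i = n then (\<tau>(x := y)) k else 0)
      = (\<lambda>(i, k). if i = n then \<tau> k else 0)((n, x) := y)" for \<tau> and y :: real
    by auto
  show ?case
    unfolding *(1) sign_mean_insert[OF *(2,3)] sign_mean_insert[OF insert.hyps] insert.IH upd ..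
qed

lemma sign_mean_union:
  assumes "finite A" "finite B" "A \<inter> B = {}"
  shows "sign_mean (A \<union> B) h = sign_mean B (\<lambda>\<tau>. sign_mean A (\<lambda>\<sigma>. h (\<lambda>x. if x \<in> A then \<sigma> x else \<tau> x)))"
proof -
  have "sign_pmf (A \<union> B) =
      sign_pmf B \<bind> (\<lambda>\<tau>. map_pmf (\<lambda>\<sigma> x. if x \<in> A then \<sigma> x else \<tau> x) (sign_pmf A))"
    unfolding sign_pmf_def Pi_pmf_union[OF assms] pair_pmf_def map_pmf_def
    by (subst bind_commute_pmf) (simp add: bind_assoc_pmf bind_return_pmf)
  then show ?thesis
    using assms by (simp add: pmf_expectation_bind[where A = "set_pmf (sign_pmf B)"]
        integral_measure_pmf[where A = "set_pmf (sign_pmf B)"])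
qed

text \<open>Separates the signs attached to the last sample, for the induction on the sample size.
  The 0 at larger indices is the default value of \<open>sign_pmf\<close>.\<close>

lemma sign_mean_Suc:
  fixes h :: "(nat \<times> 'k::finite \<Rightarrow> real) \<Rightarrow> real"
  shows "sign_mean ({..<Suc n} \<times> UNIV) h = sign_mean UNIV (\<lambda>\<tau>. sign_mean ({..<n} \<times> UNIV)
    (\<lambda>\<sigma>. h (\<lambda>(i, k). if i < n then \<sigma> (i, k) else if i = n then \<tau> k else 0)))"
proof -
  have eq: "{..<Suc n} \<times> UNIV = ({..<n} \<times> UNIV) \<union> ({n} \<times> (UNIV :: 'k set))" by auto
  have fn: "(\<lambda>x. if x \<in> {..<n} \<times> UNIV then \<sigma> x else (case x of (i, k) \<Rightarrow> if i = n then \<tau> k else 0))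
    = (\<lambda>(i, k). if i < n then \<sigma> (i, k) else if i = n then \<tau> k else 0)"
    for \<sigma> :: "nat \<times> 'k \<Rightarrow> real" and \<tau> by auto
  show ?thesis
    unfolding eq by (subst sign_mean_union) (auto simp: sign_mean_times_singleton fn)
qed

text \<open>The support is finite, so the sign mean is a finite weighted sum and commutes with the
  integral without any joint measurability. Integrability is asked only on the support, where the
  signs are bounded.\<close>

lemma
  fixes h :: "'s \<Rightarrow> ('i \<Rightarrow> real) \<Rightarrow> real"
  assumes "finite A" "\<And>\<sigma>. \<sigma> \<in> set_pmf (sign_pmf A) \<Longrightarrow> integrable M (\<lambda>s. h s \<sigma>)"
  shows integrable_sign_mean: "integrable M (\<lambda>s. sign_mean A (h s))"
    and integral_sign_mean: "(\<integral>s. sign_mean A (h s) \<partial>M) = sign_mean A (\<lambda>\<sigma>. \<integral>s. h s \<sigma> \<partial>M)"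
proof -
  have *: "sign_mean A u = (\<Sum>\<sigma>\<in>set_pmf (sign_pmf A). u \<sigma> * pmf (sign_pmf A) \<sigma>)" for u
    using assms(1) by (intro integral_measure_pmf_real) auto
  show "integrable M (\<lambda>s. sign_mean A (h s))"
    "(\<integral>s. sign_mean A (h s) \<partial>M) = sign_mean A (\<lambda>\<sigma>. \<integral>s. h s \<sigma> \<partial>M)"
    unfolding * using assms(2) by (simp_all add: integral_sum)
qed

section \<open>Bounded suprema over countable classes\<close>

lemma abs_signed_sum_le:
  assumes "finite A" "finite B" "B \<subseteq> A" "\<sigma> \<in> set_pmf (sign_pmf A)" "\<And>k. k \<in> B \<Longrightarrow> \<bar>v k\<bar> \<le> 1"
  shows "\<bar>\<Sum>k\<in>B. \<sigma> k * v k\<bar> \<le> real (card B)"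
proof -
  have "\<bar>\<sigma> k * v k\<bar> \<le> 1" if "k \<in> B" for k
  proof -
    have "\<sigma> k = -1 \<or> \<sigma> k = 1" using sign_pmf_values[OF assms(1,4)] assms(3) that by blast
    then show ?thesis using assms(5)[OF that] by auto
  qed
  then have "(\<Sum>k\<in>B. \<bar>\<sigma> k * v k\<bar>) \<le> (\<Sum>k\<in>B. 1)" by (intro sum_mono)
  then have "(\<Sum>k\<in>B. \<bar>\<sigma> k * v k\<bar>) \<le> real (card B)" by simp
  then show ?thesis by (rule order_trans[OF sum_abs])
qed

lemma bdd_above_abs_le:
  fixes u :: "'f \<Rightarrow> real"
  shows "(\<And>f. f \<in> F \<Longrightarrow> \<bar>u f\<bar> \<le> B) \<Longrightarrow> bdd_above (u ` F)"
  by (rule bdd_aboveI[where M = B]) (force simp: abs_le_iff)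

lemma abs_cSUP_le:
  fixes u :: "'f \<Rightarrow> real"
  assumes "F \<noteq> {}" "\<And>f. f \<in> F \<Longrightarrow> \<bar>u f\<bar> \<le> B"
  shows "\<bar>SUP f\<in>F. u f\<bar> \<le> B"
proof -
  obtain f where f: "f \<in> F" using assms(1) by auto
  have "u f \<le> (SUP f\<in>F. u f)"
    using f assms(2) by (intro cSUP_upper bdd_above_abs_le) auto
  moreover have "(SUP f\<in>F. u f) \<le> B"
    using assms by (intro cSUP_least) (auto simp: abs_le_iff)
  ultimately show ?thesis using assms(2)[OF f] by linarith
qed

text \<open>Countability of \<open>F\<close> gives measurability of the supremum, the uniform bound
  gives integrability.\<close>

lemma (in finite_measure) integrable_cSUP:
  fixes u :: "'f \<Rightarrow> 'a \<Rightarrow> real"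
  assumes "F \<noteq> {}" "countable F" "\<And>f. f \<in> F \<Longrightarrow> u f \<in> borel_measurable M"
    and "\<And>f s. f \<in> F \<Longrightarrow> s \<in> space M \<Longrightarrow> \<bar>u f s\<bar> \<le> B"
  shows "integrable M (\<lambda>s. SUP f\<in>F. u f s)"
proof (rule integrable_const_bound[where B = B])
  show "AE s in M. norm (SUP f\<in>F. u f s) \<le> B"
    using assms by (intro AE_I2) (simp add: abs_cSUP_le)
  show "(\<lambda>s. SUP f\<in>F. u f s) \<in> borel_measurable M"
    using assms by (intro borel_measurable_cSUP) (auto intro!: bdd_above_abs_le[where B = B])
qed

lemma (in finite_measure) integrable_cSUP_add:
  fixes u v :: "'f \<Rightarrow> 'a \<Rightarrow> real"
  assumes F: "F \<noteq> {}" "countable F"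
    and u: "\<And>f. f \<in> F \<Longrightarrow> u f \<in> borel_measurable M"
    and v: "\<And>f. f \<in> F \<Longrightarrow> v f \<in> borel_measurable M"
    and u_le: "\<And>f s. f \<in> F \<Longrightarrow> s \<in> space M \<Longrightarrow> \<bar>u f s\<bar> \<le> A"
    and v_le: "\<And>f s. f \<in> F \<Longrightarrow> s \<in> space M \<Longrightarrow> \<bar>v f s\<bar> \<le> B"
  shows "integrable M (\<lambda>s. SUP f\<in>F. u f s + v f s)"
proof (rule integrable_cSUP[OF F, where B = "A + B"])
  show "(\<lambda>s. u f s + v f s) \<in> borel_measurable M" if "f \<in> F" for f
    using u[OF that] v[OF that] by (rule borel_measurable_add)
  show "\<bar>u f s + v f s\<bar> \<le> A + B" if "f \<in> F" "s \<in> space M" for f s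
    using u_le[OF that] v_le[OF that] by linarith
qed

text \<open>The left-hand side is a mean over one Rademacher sign before \<open>h\<close>. For a
  pair \<open>f\<close>, \<open>g\<close>, the Lipschitz condition bounds \<open>h f - h g\<close>
  by a distance, and \<open>khintchine\<close> turns that distance into a mean absolute value of a
  signed sum, which splits into a term for \<open>f\<close> and a term for \<open>g\<close>. The
  offset \<open>a\<close> passes through unchanged, so the step can be iterated.\<close>

lemma vector_contraction:
  fixes p :: "'f \<Rightarrow> real ^ 'k::finite"
  assumes F: "F \<noteq> {}" and a: "\<And>f. f \<in> F \<Longrightarrow> \<bar>a f\<bar> \<le> B"
    and p: "\<And>f k. f \<in> F \<Longrightarrow> \<bar>p f $ k\<bar> \<le> 1"
    and h: "\<And>f g. f \<in> F \<Longrightarrow> g \<in> F \<Longrightarrow> \<bar>h f - h g\<bar> \<le> L * norm (p f - p g)"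
    and L: "0 \<le> L"
  shows "((SUP f\<in>F. a f + h f) + (SUP f\<in>F. a f - h f)) / 2
    \<le> sign_mean UNIV (\<lambda>\<sigma>. SUP f\<in>F. a f + sqrt 2 * L * (\<Sum>k\<in>UNIV. \<sigma> k * p f $ k))"
proof -
  define S where "S \<sigma> = (SUP f\<in>F. a f + sqrt 2 * L * (\<Sum>k\<in>UNIV. \<sigma> k * p f $ k))" for \<sigma>
  have S: "a f + sqrt 2 * L * (\<Sum>k\<in>UNIV. \<sigma> k * p f $ k) \<le> S \<sigma>"
    if f: "f \<in> F" and \<sigma>: "\<sigma> \<in> set_pmf (sign_pmf UNIV)" for f \<sigma>
  proof -
    have "\<bar>a f + sqrt 2 * L * (\<Sum>k\<in>UNIV. \<sigma> k * p f $ k)\<bar> \<le> B + sqrt 2 * L * real CARD('k)"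
      if f: "f \<in> F" for f
    proof -
      have "\<bar>\<Sum>k\<in>UNIV. \<sigma> k * p f $ k\<bar> \<le> real CARD('k)"
        using \<sigma> p[OF f] by (intro abs_signed_sum_le[where A = UNIV]) auto
      then have "\<bar>sqrt 2 * L * (\<Sum>k\<in>UNIV. \<sigma> k * p f $ k)\<bar> \<le> sqrt 2 * L * real CARD('k)"
        using L by (simp add: abs_mult mult_left_mono)
      then show ?thesis using a[OF f] by linarith
    qed
    then show ?thesis
      unfolding S_def using f by (intro cSUP_upper bdd_above_abs_le)
  qed
  have pair: "(a f + h f) + (a g - h g) \<le> 2 * sign_mean UNIV S" if fg: "f \<in> F" "g \<in> F" for f g
  proof -
    have "norm (p f - p g) = sqrt (\<Sum>k\<in>UNIV. ((p f - p g) $ k)\<^sup>2)"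
      by (simp add: norm_vec_def L2_set_def)
    also have "\<dots> \<le> sqrt 2 * sign_mean UNIV (\<lambda>\<sigma>. \<bar>\<Sum>k\<in>UNIV. \<sigma> k * (p f - p g) $ k\<bar>)"
      by (rule khintchine) simp
    finally have "L * norm (p f - p g)
      \<le> L * (sqrt 2 * sign_mean UNIV (\<lambda>\<sigma>. \<bar>\<Sum>k\<in>UNIV. \<sigma> k * (p f - p g) $ k\<bar>))"
      using L by (rule mult_left_mono)
    then have "(a f + h f) + (a g - h g)
      \<le> a f + a g + sqrt 2 * L * sign_mean UNIV (\<lambda>\<sigma>. \<bar>\<Sum>k\<in>UNIV. \<sigma> k * (p f - p g) $ k\<bar>)"
      using h[OF fg] by (simp add: ac_simps)
    also have "\<dots> = sign_mean UNIV (\<lambda>\<sigma>. a f + a g + sqrt 2 * L * \<bar>\<Sum>k\<in>UNIV. \<sigma> k * (p f - p g) $ k\<bar>)"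
      by simp
    also have "\<dots> \<le> sign_mean UNIV (\<lambda>\<sigma>. S \<sigma> + S (\<lambda>k. - \<sigma> k))"
    proof (rule sign_mean_mono)
      fix \<sigma> :: "'k \<Rightarrow> real" assume \<sigma>: "\<sigma> \<in> set_pmf (sign_pmf UNIV)"
      then have \<sigma>': "(\<lambda>k. - \<sigma> k) \<in> set_pmf (sign_pmf UNIV)"
        by (auto simp: sign_pmf_def set_Pi_pmf PiE_dflt_def)
      let ?x = "\<Sum>k\<in>UNIV. \<sigma> k * p f $ k" and ?y = "\<Sum>k\<in>UNIV. \<sigma> k * p g $ k"
      have eq: "(\<Sum>k\<in>UNIV. \<sigma> k * (p f - p g) $ k) = ?x - ?y"
        by (simp add: sum_subtractf right_diff_distrib)
      have "a f + sqrt 2 * L * ?x \<le> S \<sigma>" "a g + sqrt 2 * L * ?y \<le> S \<sigma>"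
        "a f - sqrt 2 * L * ?x \<le> S (\<lambda>k. - \<sigma> k)" "a g - sqrt 2 * L * ?y \<le> S (\<lambda>k. - \<sigma> k)"
        using S[OF fg(1) \<sigma>] S[OF fg(2) \<sigma>] S[OF fg(1) \<sigma>'] S[OF fg(2) \<sigma>']
        by (simp_all add: sum_negf)
      then show "a f + a g + sqrt 2 * L * \<bar>\<Sum>k\<in>UNIV. \<sigma> k * (p f - p g) $ k\<bar> \<le> S \<sigma> + S (\<lambda>k. - \<sigma> k)"
        \<comment> \<open>If \<open>?x \<ge> ?y\<close>, then \<open>f\<close> is paired with
          \<open>\<sigma>\<close> and \<open>g\<close> with its negative; otherwise the roles are
          exchanged.\<close>
        unfolding eq by (cases "?x \<ge> ?y") (simp_all add: right_diff_distrib)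
    qed simp
    also have "\<dots> = 2 * sign_mean UNIV S"
      by (simp add: sign_mean_uminus)
    finally show ?thesis .
  qed
  have "(SUP f\<in>F. a f - h f) \<le> 2 * sign_mean UNIV S - (a f + h f)" if "f \<in> F" for f
    using F pair[OF that] by (intro cSUP_least) (auto simp: algebra_simps)
  then have "(SUP f\<in>F. a f + h f) \<le> 2 * sign_mean UNIV S - (SUP f\<in>F. a f - h f)"
    using F by (intro cSUP_least) (auto simp: algebra_simps)
  then have "((SUP f\<in>F. a f + h f) + (SUP f\<in>F. a f - h f)) / 2 \<le> sign_mean UNIV S" by simp
  then show ?thesis unfolding S_def .
qed

text \<open>Integrating the pointwise bound \<open>a f + l f t - l f s \<le> (T t + T' s) / 2\<close> over \<open>t\<close>, with
  \<open>T\<close>, \<open>T'\<close> the two suprema on the right, replaces the usual ghost sample.\<close>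

lemma (in prob_space) symmetrization_step:
  fixes l :: "'f \<Rightarrow> 'a \<Rightarrow> real"
  assumes F: "F \<noteq> {}" "countable F" and a: "\<And>f. f \<in> F \<Longrightarrow> \<bar>a f\<bar> \<le> B"
    and l: "\<And>f. f \<in> F \<Longrightarrow> l f \<in> borel_measurable M"
    "\<And>f s. f \<in> F \<Longrightarrow> s \<in> space M \<Longrightarrow> \<bar>l f s\<bar> \<le> b"
  shows "(\<integral>s. (SUP f\<in>F. a f + (expectation (l f) - l f s)) \<partial>M)
    \<le> (\<integral>s. ((SUP f\<in>F. a f + 2 * l f s) + (SUP f\<in>F. a f - 2 * l f s)) / 2 \<partial>M)"
proof -
  define T where "T s = (SUP f\<in>F. a f + 2 * l f s)" for s
  define T' where "T' s = (SUP f\<in>F. a f - 2 * l f s)" for s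
  note [measurable] = l(1)
  have bnd: "\<bar>a f + 2 * l f s\<bar> \<le> B + 2 * b" "\<bar>a f - 2 * l f s\<bar> \<le> B + 2 * b"
    if "f \<in> F" "s \<in> space M" for f s
    using a[OF that(1)] l(2)[OF that] by linarith+
  have int: "integrable M T" "integrable M T'"
    unfolding T_def T'_def using F bnd by (intro integrable_cSUP[where B = "B + 2 * b"]; simp)+
  have l_int: "integrable M (l f)" if "f \<in> F" for f
    using l that by (intro integrable_const_bound[where B = b]) auto
  have ptw: "a f + expectation (l f) - l f s \<le> expectation T / 2 + T' s / 2"
    if f: "f \<in> F" and s: "s \<in> space M" for f s
  proof -
    have "l f t \<le> T t / 2 + (T' s / 2 + l f s - a f)" if t: "t \<in> space M" for t
    proof -
      have "a f + 2 * l f t \<le> T t" "a f - 2 * l f s \<le> T' s"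
        unfolding T_def T'_def using f s t bnd
        by (auto intro!: cSUP_upper bdd_above_abs_le[where B = "B + 2 * b"])
      then show ?thesis by simp
    qed
    then have "expectation (l f) \<le> expectation (\<lambda>t. T t / 2 + (T' s / 2 + l f s - a f))"
      using l_int[OF f] int(1) by (intro integral_mono) auto
    then show ?thesis using int(1) by (simp add: prob_space)
  qed
  have e_bnd: "\<bar>expectation (l f)\<bar> \<le> b" if "f \<in> F" for f
  proof -
    have "\<bar>expectation (l f)\<bar> \<le> expectation (\<lambda>s. \<bar>l f s\<bar>)" by simp
    also have "\<dots> \<le> expectation (\<lambda>s. b)"
      using l_int l(2) that by (intro integral_mono) auto
    finally show ?thesis by (simp add: prob_space)
  qed
  have "(\<integral>s. (SUP f\<in>F. a f + (expectation (l f) - l f s)) \<partial>M)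
    \<le> (\<integral>s. expectation T / 2 + T' s / 2 \<partial>M)"
  proof (rule integral_mono)
    have "\<bar>a f + (expectation (l f) - l f s)\<bar> \<le> B + 2 * b" if "f \<in> F" "s \<in> space M" for f s
      using a e_bnd l(2) that by (smt (verit))
    then show "integrable M (\<lambda>s. SUP f\<in>F. a f + (expectation (l f) - l f s))"
      using F by (intro integrable_cSUP) auto
    show "(SUP f\<in>F. a f + (expectation (l f) - l f s)) \<le> expectation T / 2 + T' s / 2"
      if "s \<in> space M" for s
      using F ptw[OF _ that] by (intro cSUP_least) (auto simp: algebra_simps)
  qed (use int in simp)
  \<comment> \<open>The halves come from two independent points, but their means add, so both may be
    evaluated at the same \<open>s\<close>.\<close>
  also have "\<dots> = (\<integral>s. (T s + T' s) / 2 \<partial>M)"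
    using int by (simp add: prob_space add_divide_distrib)
  finally show ?thesis unfolding T_def T'_def .
qed

section \<open>McDiarmid's inequality\<close>

lemma (in prob_space) hoeffding_mgf:
  fixes f :: "'a \<Rightarrow> real"
  assumes f [measurable]: "f \<in> borel_measurable M"
    and osc: "\<And>x y. x \<in> space M \<Longrightarrow> y \<in> space M \<Longrightarrow> f x - f y \<le> c"
    and t: "0 < t"
  shows "expectation (\<lambda>x. exp (t * f x)) \<le> exp (t * expectation f) * exp (t\<^sup>2 * c\<^sup>2 / 8)"
proof -
  obtain x0 where x0: "x0 \<in> space M" using not_empty by auto
  have bdd: "bdd_below (f ` space M)"
    using osc[OF x0] by (intro bdd_belowI[where m = "f x0 - c"]) (auto simp: algebra_simps)
  define a where "a = (INF x\<in>space M. f x)"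
  have a: "a \<le> f x" "f x \<le> a + c" if x: "x \<in> space M" for x
  proof -
    show "a \<le> f x" unfolding a_def using bdd x by (intro cINF_lower)
    have "f x - c \<le> a"
      unfolding a_def using osc[OF x] x by (intro cINF_greatest) (auto simp: algebra_simps)
    then show "f x \<le> a + c" by simp
  qed
  interpret interval_bounded_random_variable M f a "a + c"
  proof unfold_locales
    show "f \<in> borel_measurable M" by (rule f)
    show "AE x in M. f x \<in> {a..a + c}" using a by auto
  qed
  have f_int: "integrable M f"
  proof (rule integrable_const_bound[where B = "\<bar>a\<bar> + \<bar>c\<bar>", OF _ f], rule AE_I2)
    show "norm (f x) \<le> \<bar>a\<bar> + \<bar>c\<bar>" if "x \<in> space M" for x
      using a[OF that] by (auto simp: abs_if)
  qed
  have "integrable M (\<lambda>x. exp (t * f x))"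
    using a(2) t by (intro integrable_const_bound[where B = "exp (t * (a + c))"]) auto
  then have int: "integrable M (\<lambda>x. exp (t * (f x - expectation f)))"
    by (simp add: right_diff_distrib exp_diff)
  have "ennreal (expectation (\<lambda>x. exp (t * (f x - expectation f))))
      = (\<integral>\<^sup>+x. exp (t * (f x - expectation f)) \<partial>M)"
    using int by (intro nn_integral_eq_integral[symmetric]) auto
  also have "\<dots> \<le> ennreal (exp (t\<^sup>2 * (a + c - a)\<^sup>2 / 8))"
    by (rule Hoeffdings_lemma_nn_integral) (rule t)
  finally have "expectation (\<lambda>x. exp (t * (f x - expectation f))) \<le> exp (t\<^sup>2 * c\<^sup>2 / 8)"
    by simp
  moreover have "expectation (\<lambda>x. exp (t * f x))
      = exp (t * expectation f) * expectation (\<lambda>x. exp (t * (f x - expectation f)))"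
    by (simp add: right_diff_distrib exp_diff)
  ultimately show ?thesis
    by simp
qed

text \<open>The martingale argument as an induction: given the first \<open>n\<close> coordinates,
  the last one costs a factor \<open>exp (t\<^sup>2 * c\<^sup>2 / 8)\<close> by
  \<open>hoeffding_mgf\<close>, and the conditional mean \<open>\<Psi>\<close> inherits the bounded
  differences. The bound \<open>B\<close> serves integrability and does not enter the
  estimate.\<close>

lemma (in prob_space) bounded_differences_mgf:
  fixes \<Phi> :: "(nat \<Rightarrow> 'a) \<Rightarrow> real"
  assumes "\<Phi> \<in> borel_measurable (PiM {..<n} (\<lambda>_. M))"
    and "\<And>s. s \<in> space (PiM {..<n} (\<lambda>_. M)) \<Longrightarrow> \<bar>\<Phi> s\<bar> \<le> B"
    and "\<And>s i x. s \<in> space (PiM {..<n} (\<lambda>_. M)) \<Longrightarrow> i < n \<Longrightarrow> x \<in> space M \<Longrightarrow> \<Phi> (s(i := x)) - \<Phi> s \<le> c"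
    and t: "0 < t"
  shows "(\<integral>s. exp (t * \<Phi> s) \<partial>PiM {..<n} (\<lambda>_. M))
    \<le> exp (t * (\<integral>s. \<Phi> s \<partial>PiM {..<n} (\<lambda>_. M))) * exp (real n * (t\<^sup>2 * c\<^sup>2 / 8))"
  using assms(1-3)
proof (induction n arbitrary: \<Phi>)
  case 0
  interpret M0: prob_space "PiM ({} :: nat set) (\<lambda>_. M)"
    by (intro prob_space_PiM prob_space_axioms)
  have "(\<integral>s. h s \<partial>PiM ({} :: nat set) (\<lambda>_. M)) = h (\<lambda>_. undefined)" for h :: "(nat \<Rightarrow> 'a) \<Rightarrow> real"
  proof -
    have "(\<integral>s. h s \<partial>PiM ({} :: nat set) (\<lambda>_. M)) = (\<integral>s. h (\<lambda>_. undefined) \<partial>PiM ({} :: nat set) (\<lambda>_. M))"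
      by (intro Bochner_Integration.integral_cong) (auto simp: space_PiM)
    then show ?thesis using M0.prob_space by simp
  qed
  then show ?case by simp
next
  case (Suc n)
  interpret Mn: prob_space "PiM {..<n} (\<lambda>_. M)"
    by (intro prob_space_PiM prob_space_axioms)
  interpret MSn: prob_space "PiM {..<Suc n} (\<lambda>_. M)"
    by (intro prob_space_PiM prob_space_axioms)
  interpret P: product_sigma_finite "\<lambda>_::nat. M" by unfold_locales
  interpret MM: pair_prob_space "PiM {..<n} (\<lambda>_. M)" M ..
  have ins: "{..<Suc n} = insert n {..<n}" by auto
  let ?u = "\<lambda>(s, x). s(n := x)"
  have u [measurable]: "?u \<in> measurable (PiM {..<n} (\<lambda>_. M) \<Otimes>\<^sub>M M) (PiM {..<Suc n} (\<lambda>_. M))"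
    unfolding ins by (rule measurable_add_dim)
  have upd: "s(n := x) \<in> space (PiM {..<Suc n} (\<lambda>_. M))"
    if "s \<in> space (PiM {..<n} (\<lambda>_. M))" "x \<in> space M" for s x
    using measurable_space[OF u, of "(s, x)"] that by (simp add: space_pair_measure)
  note [measurable] = Suc.prems(1)
  have \<Phi>u [measurable]: "(\<lambda>(s, x). \<Phi> (s(n := x))) \<in> borel_measurable (PiM {..<n} (\<lambda>_. M) \<Otimes>\<^sub>M M)"
    using measurable_compose[OF u Suc.prems(1)] by (simp add: case_prod_beta)
  have \<Phi>u_int: "integrable (PiM {..<n} (\<lambda>_. M) \<Otimes>\<^sub>M M) (\<lambda>(s, x). \<Phi> (s(n := x)))"
    using Suc.prems(2) upd
    by (intro MM.integrable_const_bound[where B = B]) (auto simp: space_pair_measure)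
  have exp_int: "integrable (PiM {..<n} (\<lambda>_. M) \<Otimes>\<^sub>M M) (\<lambda>(s, x). exp (t * \<Phi> (s(n := x))))"
  proof (rule MM.integrable_const_bound[where B = "exp (t * B)"])
    show "AE y in PiM {..<n} (\<lambda>_. M) \<Otimes>\<^sub>M M. norm (case y of (s, x) \<Rightarrow> exp (t * \<Phi> (s(n := x)))) \<le> exp (t * B)"
    proof (rule AE_I2)
      fix y assume "y \<in> space (PiM {..<n} (\<lambda>_. M) \<Otimes>\<^sub>M M)"
      then have "\<Phi> ((fst y)(n := snd y)) \<le> B"
        by (intro abs_le_D1[OF Suc.prems(2)] upd) (auto simp: space_pair_measure)
      then show "norm (case y of (s, x) \<Rightarrow> exp (t * \<Phi> (s(n := x)))) \<le> exp (t * B)"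
        using t by (simp add: case_prod_beta)
    qed
    show "(\<lambda>(s, x). exp (t * \<Phi> (s(n := x)))) \<in> borel_measurable (PiM {..<n} (\<lambda>_. M) \<Otimes>\<^sub>M M)"
      using \<Phi>u by (simp add: case_prod_beta)
  qed
  have sec: "(\<lambda>x. \<Phi> (s(n := x))) \<in> borel_measurable M" if "s \<in> space (PiM {..<n} (\<lambda>_. M))" for s
    using measurable_Pair2[OF \<Phi>u that] by simp
  have sec_int: "integrable M (\<lambda>x. \<Phi> (s(n := x)))" if "s \<in> space (PiM {..<n} (\<lambda>_. M))" for s
    using sec[OF that] Suc.prems(2) upd[OF that] by (intro integrable_const_bound[where B = B]) auto
  define \<Psi> where "\<Psi> s = (\<integral>x. \<Phi> (s(n := x)) \<partial>M)" for s
  have \<Psi>_meas [measurable]: "\<Psi> \<in> borel_measurable (PiM {..<n} (\<lambda>_. M))"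
    unfolding \<Psi>_def by (rule borel_measurable_lebesgue_integral) (use \<Phi>u in simp)
  have \<Psi>_bnd: "\<bar>\<Psi> s\<bar> \<le> B" if "s \<in> space (PiM {..<n} (\<lambda>_. M))" for s
  proof -
    have "\<bar>\<Psi> s\<bar> \<le> (\<integral>x. \<bar>\<Phi> (s(n := x))\<bar> \<partial>M)" unfolding \<Psi>_def by (rule integral_abs_bound)
    also have "\<dots> \<le> (\<integral>x. B \<partial>M)"
      using sec_int[OF that] Suc.prems(2) upd[OF that] by (intro integral_mono) auto
    finally show ?thesis by (simp add: prob_space)
  qed
  have \<Psi>_diff: "\<Psi> (s(i := x)) - \<Psi> s \<le> c"
    if s: "s \<in> space (PiM {..<n} (\<lambda>_. M))" and i: "i < n" and x: "x \<in> space M" for s i x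
  proof -
    have s': "s(i := x) \<in> space (PiM {..<n} (\<lambda>_. M))"
      using s i x by (auto simp: space_PiM PiE_iff extensional_def)
    have "\<Psi> (s(i := x)) \<le> (\<integral>y. \<Phi> (s(n := y)) + c \<partial>M)"
      unfolding \<Psi>_def
    proof (rule integral_mono)
      fix y assume y: "y \<in> space M"
      \<comment> \<open>Updates at distinct indices commute, so averaging over the last coordinate
        keeps the difference bound.\<close>
      have "(s(i := x))(n := y) = (s(n := y))(i := x)" using i by (simp add: fun_upd_twist)
      then show "\<Phi> ((s(i := x))(n := y)) \<le> \<Phi> (s(n := y)) + c"
        using Suc.prems(3)[OF upd[OF s y], of i x] i x by (simp del: fun_upd_apply)
    qed (use sec_int[OF s] sec_int[OF s'] in auto)
    also have "\<dots> = \<Psi> s + c" using sec_int[OF s] by (simp add: \<Psi>_def prob_space)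
    finally show ?thesis by simp
  qed
  have inner: "(\<integral>x. exp (t * \<Phi> (s(n := x))) \<partial>M) \<le> exp (t * \<Psi> s) * exp (t\<^sup>2 * c\<^sup>2 / 8)"
    if s: "s \<in> space (PiM {..<n} (\<lambda>_. M))" for s
    unfolding \<Psi>_def
  proof (rule hoeffding_mgf[OF sec[OF s] _ t])
    fix x y assume "x \<in> space M" "y \<in> space M"
    then show "\<Phi> (s(n := x)) - \<Phi> (s(n := y)) \<le> c"
      using Suc.prems(3)[OF upd[OF s \<open>y \<in> space M\<close>], of n x] by (simp del: fun_upd_apply)
  qed
  have \<Phi>_int: "integrable (PiM (insert n {..<n}) (\<lambda>_. M)) \<Phi>"
    using Suc.prems unfolding ins[symmetric] by (intro MSn.integrable_const_bound[where B = B]) auto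
  have exp\<Phi>_int: "integrable (PiM (insert n {..<n}) (\<lambda>_. M)) (\<lambda>s. exp (t * \<Phi> s))"
    unfolding ins[symmetric] using Suc.prems t
    by (intro MSn.integrable_const_bound[where B = "exp (t * B)"]) (auto simp: abs_le_iff)
  have "(\<integral>s. exp (t * \<Phi> s) \<partial>PiM {..<Suc n} (\<lambda>_. M))
      = (\<integral>s. (\<integral>x. exp (t * \<Phi> (s(n := x))) \<partial>M) \<partial>PiM {..<n} (\<lambda>_. M))"
    unfolding ins by (rule P.product_integral_insert[OF _ _ exp\<Phi>_int]) auto
  also have "\<dots> \<le> (\<integral>s. exp (t * \<Psi> s) * exp (t\<^sup>2 * c\<^sup>2 / 8) \<partial>PiM {..<n} (\<lambda>_. M))"
  proof (rule integral_mono[OF _ _ inner])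
    show "integrable (PiM {..<n} (\<lambda>_. M)) (\<lambda>s. \<integral>x. exp (t * \<Phi> (s(n := x))) \<partial>M)"
      using exp_int by (rule MM.integrable_fst)
    show "integrable (PiM {..<n} (\<lambda>_. M)) (\<lambda>s. exp (t * \<Psi> s) * exp (t\<^sup>2 * c\<^sup>2 / 8))"
      using \<Psi>_bnd t
      by (intro integrable_mult_left Mn.integrable_const_bound[where B = "exp (t * B)"])
        (auto simp: abs_le_iff)
  qed
  also have "\<dots> \<le> (exp (t * (\<integral>s. \<Psi> s \<partial>PiM {..<n} (\<lambda>_. M))) * exp (real n * (t\<^sup>2 * c\<^sup>2 / 8)))
      * exp (t\<^sup>2 * c\<^sup>2 / 8)"
    unfolding integral_mult_left_zero
    by (intro mult_right_mono Suc.IH \<Psi>_meas \<Psi>_bnd \<Psi>_diff) auto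
  also have "(\<integral>s. \<Psi> s \<partial>PiM {..<n} (\<lambda>_. M)) = (\<integral>s. \<Phi> s \<partial>PiM {..<Suc n} (\<lambda>_. M))"
    unfolding ins \<Psi>_def by (rule P.product_integral_insert[OF _ _ \<Phi>_int, symmetric]) auto
  finally have "(\<integral>s. exp (t * \<Phi> s) \<partial>PiM {..<Suc n} (\<lambda>_. M))
    \<le> exp (t * (\<integral>s. \<Phi> s \<partial>PiM {..<Suc n} (\<lambda>_. M))) * exp (real n * (t\<^sup>2 * c\<^sup>2 / 8)) * exp (t\<^sup>2 * c\<^sup>2 / 8)" .
  moreover have "exp (real (Suc n) * q) = exp (real n * q) * exp q" for q :: real
    by (simp add: exp_add[symmetric] algebra_simps)
  ultimately show ?case by (simp only: mult.assoc)
qed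

lemma (in prob_space) mcdiarmid:
  fixes \<Phi> :: "(nat \<Rightarrow> 'a) \<Rightarrow> real"
  assumes \<Phi> [measurable]: "\<Phi> \<in> borel_measurable (PiM {..<n} (\<lambda>_. M))"
    and bnd: "\<And>s. s \<in> space (PiM {..<n} (\<lambda>_. M)) \<Longrightarrow> \<bar>\<Phi> s\<bar> \<le> B"
    and diff: "\<And>s i x. s \<in> space (PiM {..<n} (\<lambda>_. M)) \<Longrightarrow> i < n \<Longrightarrow> x \<in> space M \<Longrightarrow> \<Phi> (s(i := x)) - \<Phi> s \<le> c"
    and c: "0 < c" and n: "0 < n" and \<epsilon>: "0 \<le> \<epsilon>"
  shows "\<P>(s in PiM {..<n} (\<lambda>_. M). (\<integral>s. \<Phi> s \<partial>PiM {..<n} (\<lambda>_. M)) + \<epsilon> < \<Phi> s)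
    \<le> exp (- 2 * \<epsilon>\<^sup>2 / (real n * c\<^sup>2))"
proof (cases "\<epsilon> = 0")
  interpret Mn: prob_space "PiM {..<n} (\<lambda>_. M)"
    by (intro prob_space_PiM prob_space_axioms)
  \<comment> \<open>The optimal \<open>t\<close> would be 0 here, outside the range of
    \<open>bounded_differences_mgf\<close>; the claimed bound is 1.\<close>
  case True
  then show ?thesis by simp
next
  interpret Mn: prob_space "PiM {..<n} (\<lambda>_. M)"
    by (intro prob_space_PiM prob_space_axioms)
  case False
  \<comment> \<open>Minimizes the exponent
    \<open>real n * (t\<^sup>2 * c\<^sup>2 / 8) - t * \<epsilon>\<close> obtained from Markov's
    inequality.\<close>
  define t where "t = 4 * \<epsilon> / (real n * c\<^sup>2)"
  have t: "0 < t" using False \<epsilon> n c by (simp add: t_def)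
  let ?m = "\<integral>s. \<Phi> s \<partial>PiM {..<n} (\<lambda>_. M)"
  have int: "integrable (PiM {..<n} (\<lambda>_. M)) (\<lambda>s. exp (t * \<Phi> s))"
    using bnd t by (intro Mn.integrable_const_bound[where B = "exp (t * B)"]) (auto simp: abs_le_iff)
  have "\<P>(s in PiM {..<n} (\<lambda>_. M). ?m + \<epsilon> < \<Phi> s)
      \<le> \<P>(s in PiM {..<n} (\<lambda>_. M). exp (t * (?m + \<epsilon>)) \<le> exp (t * \<Phi> s))"
    using t by (intro Mn.finite_measure_mono) auto
  also have "\<dots> \<le> (\<integral>s. exp (t * \<Phi> s) \<partial>PiM {..<n} (\<lambda>_. M)) / exp (t * (?m + \<epsilon>))"
    using int by (intro integral_Markov_inequality_measure[where A = "{}"]) auto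
  also have "\<dots> \<le> (exp (t * ?m) * exp (real n * (t\<^sup>2 * c\<^sup>2 / 8))) / exp (t * (?m + \<epsilon>))"
    using \<Phi> bnd diff t by (intro divide_right_mono bounded_differences_mgf) auto
  also have "\<dots> = exp (real n * (t\<^sup>2 * c\<^sup>2 / 8) - t * \<epsilon>)"
    by (simp add: exp_add exp_diff distrib_left)
  also have "real n * (t\<^sup>2 * c\<^sup>2 / 8) - t * \<epsilon> = - 2 * \<epsilon>\<^sup>2 / (real n * c\<^sup>2)"
    using n c by (simp add: t_def power2_eq_square field_simps)
  finally show ?thesis .
qed

section \<open>The uniform deviation of a Lipschitz loss class\<close>

lemma borel_measurable_PiM_component:
  "h \<in> borel_measurable M \<Longrightarrow> i < n \<Longrightarrow> (\<lambda>x. h (x i)) \<in> borel_measurable (PiM {..<n} (\<lambda>_. M))"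
  by (rule measurable_compose[OF measurable_component_singleton[of i "{..<n}" "\<lambda>_. M"]]) auto

text \<open>A hypothesis sees a data point only through \<open>g\<close>, while the loss sees all of
  it. As \<open>L\<close> is the same for every data point, contraction removes the label, and only
  the law \<open>distr D Y g\<close> of the features enters the complexity.\<close>

locale lipschitz_loss_class = prob_space D for D :: "'s measure" +
  fixes F :: "'f set" and Y :: "'y measure" and g :: "'s \<Rightarrow> 'y"
    and l :: "'f \<Rightarrow> 's \<Rightarrow> real" and p :: "'f \<Rightarrow> 'y \<Rightarrow> real ^ 'k::finite" and b L :: real
  assumes F: "F \<noteq> {}" "countable F"
    and g [measurable]: "g \<in> measurable D Y"
    and l [measurable]: "\<And>f. f \<in> F \<Longrightarrow> l f \<in> borel_measurable D"
    and l_bound: "\<And>f s. f \<in> F \<Longrightarrow> s \<in> space D \<Longrightarrow> \<bar>l f s\<bar> \<le> b"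
    and p [measurable]: "\<And>f. f \<in> F \<Longrightarrow> p f \<in> borel_measurable Y"
    and p_bound: "\<And>f y k. f \<in> F \<Longrightarrow> y \<in> space Y \<Longrightarrow> \<bar>p f y $ k\<bar> \<le> 1"
    and L: "0 \<le> L"
    and l_lipschitz: "\<And>f f' s. f \<in> F \<Longrightarrow> f' \<in> F \<Longrightarrow> s \<in> space D \<Longrightarrow>
          \<bar>l f s - l f' s\<bar> \<le> L * norm (p f (g s) - p f' (g s))"
begin

text \<open>The factor \<open>2\<close> is the price of symmetrization, \<open>sqrt 2\<close> that of contraction.\<close>

definition C :: real where "C = 2 * sqrt 2 * L"

abbreviation m :: "'f \<Rightarrow> real" where "m f \<equiv> expectation (l f)"

abbreviation DY :: "'y measure" where "DY \<equiv> distr D Y g"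

text \<open>Not normalized by \<open>n\<close>. In the induction the offset \<open>a\<close> carries
  the signed sums of the samples already exchanged; the final bound takes it to be 0.\<close>

definition dev_sup :: "nat \<Rightarrow> ('f \<Rightarrow> real) \<Rightarrow> (nat \<Rightarrow> 's) \<Rightarrow> real" where
  "dev_sup n a s = (SUP f\<in>F. a f + (\<Sum>i<n. m f - l f (s i)))"

definition rad_sup :: "nat \<Rightarrow> ('f \<Rightarrow> real) \<Rightarrow> (nat \<times> 'k \<Rightarrow> real) \<Rightarrow> (nat \<Rightarrow> 'y) \<Rightarrow> real" where
  "rad_sup n a \<sigma> x = (SUP f\<in>F. a f + C * (\<Sum>i<n. \<Sum>k\<in>UNIV. \<sigma> (i, k) * p f (x i) $ k))"

section \<open>Bounds, measurability and integrability of the two suprema\<close>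

lemma C_nonneg: "0 \<le> C" using L by (simp add: C_def)

lemma p_measurable [measurable]: "f \<in> F \<Longrightarrow> (\<lambda>y. p f y $ k) \<in> borel_measurable Y"
  by (rule measurable_compose[OF p])
    (auto intro!: borel_measurable_continuous_onI continuous_intros)

lemma prob_space_DY: "prob_space DY"
  by (rule prob_space_distr) measurable

lemma prob_space_samples: "prob_space (PiM I (\<lambda>_. D))" "prob_space (PiM I (\<lambda>_. DY))"
  using prob_space_DY prob_space_axioms by (auto intro!: prob_space_PiM)

lemma space_PiM_D: "s \<in> space (PiM {..<n} (\<lambda>_. D)) \<Longrightarrow> i < n \<Longrightarrow> s i \<in> space D"
  by (auto simp: space_PiM)

lemma space_PiM_DY: "s \<in> space (PiM {..<n} (\<lambda>_. DY)) \<Longrightarrow> i < n \<Longrightarrow> s i \<in> space Y"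
  by (auto simp: space_PiM)

lemma space_pair_D: "\<omega> \<in> space (M' \<Otimes>\<^sub>M D) \<Longrightarrow> snd \<omega> \<in> space D"
  by (auto simp: space_pair_measure)

lemma space_pair_DY: "\<omega> \<in> space (M' \<Otimes>\<^sub>M DY) \<Longrightarrow> snd \<omega> \<in> space Y"
  by (auto simp: space_pair_measure)

lemma space_pair_fst: "\<omega> \<in> space (M' \<Otimes>\<^sub>M M'') \<Longrightarrow> fst \<omega> \<in> space M'"
  by (auto simp: space_pair_measure)

lemma m_bound: "f \<in> F \<Longrightarrow> \<bar>m f\<bar> \<le> b"
proof -
  assume f: "f \<in> F"
  have "integrable D (l f)"
    using l l_bound f by (intro integrable_const_bound[where B = b]) auto
  then have "\<bar>m f\<bar> \<le> expectation (\<lambda>s. b)"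
    using l_bound f by (intro order_trans[OF integral_abs_bound] integral_mono) auto
  then show ?thesis by (simp add: prob_space)
qed

lemma dev_bound: "f \<in> F \<Longrightarrow> s \<in> space (PiM {..<n} (\<lambda>_. D)) \<Longrightarrow> \<bar>\<Sum>i<n. m f - l f (s i)\<bar> \<le> real n * (2 * b)"
proof -
  assume f: "f \<in> F" and s: "s \<in> space (PiM {..<n} (\<lambda>_. D))"
  have "\<bar>m f - l f (s i)\<bar> \<le> 2 * b" if "i < n" for i
    using m_bound[OF f] l_bound[OF f space_PiM_D[OF s that]] by linarith
  then have "(\<Sum>i<n. \<bar>m f - l f (s i)\<bar>) \<le> (\<Sum>i<n. 2 * b)" by (intro sum_mono) auto
  also have "\<dots> = real n * (2 * b)" by simp
  finally show ?thesis by (rule order_trans[OF sum_abs])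
qed

lemma signed_sum_bound:
  "f \<in> F \<Longrightarrow> \<tau> \<in> set_pmf (sign_pmf UNIV) \<Longrightarrow> y \<in> space Y \<Longrightarrow>
    \<bar>C * (\<Sum>k\<in>UNIV. \<tau> k * p f y $ k)\<bar> \<le> C * real CARD('k)"
  using abs_signed_sum_le[of UNIV UNIV \<tau> "\<lambda>k. p f y $ k"] p_bound C_nonneg
  by (simp add: abs_mult mult_left_mono)

lemma rad_bound:
  assumes "f \<in> F" "\<sigma> \<in> set_pmf (sign_pmf ({..<n} \<times> UNIV))" "x \<in> space (PiM {..<n} (\<lambda>_. DY))"
  shows "\<bar>C * (\<Sum>i<n. \<Sum>k\<in>UNIV. \<sigma> (i, k) * p f (x i) $ k)\<bar> \<le> C * (real n * real CARD('k))"
proof -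
  have "(\<Sum>i<n. \<Sum>k\<in>UNIV. \<sigma> (i, k) * p f (x i) $ k)
      = (\<Sum>j\<in>{..<n} \<times> UNIV. \<sigma> j * (p f (x (fst j)) $ snd j))"
    by (simp add: sum.cartesian_product case_prod_beta)
  also have "\<bar>\<dots>\<bar> \<le> real (card ({..<n} \<times> (UNIV::'k set)))"
    using assms p_bound space_PiM_DY[OF assms(3)] by (intro abs_signed_sum_le[where A = "{..<n} \<times> UNIV"]) auto
  finally show ?thesis
    using C_nonneg by (simp add: abs_mult mult_left_mono)
qed

lemma dev_measurable:
  "f \<in> F \<Longrightarrow> (\<lambda>s. \<Sum>i<n. m f - l f (s i)) \<in> borel_measurable (PiM {..<n} (\<lambda>_. D))"
  by (intro borel_measurable_sum borel_measurable_diff borel_measurable_const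
      borel_measurable_PiM_component l) auto

lemma signed_sum_measurable:
  "f \<in> F \<Longrightarrow> (\<lambda>y. C * (\<Sum>k\<in>UNIV. \<tau> k * p f y $ k)) \<in> borel_measurable DY"
  unfolding measurable_distr_eq1
  by (intro borel_measurable_sum borel_measurable_times borel_measurable_const p_measurable)

lemma rad_measurable:
  assumes "f \<in> F"
  shows "(\<lambda>x. C * (\<Sum>i<n. \<Sum>k\<in>UNIV. \<sigma> (i, k) * p f (x i) $ k)) \<in> borel_measurable (PiM {..<n} (\<lambda>_. DY))"
proof -
  have "(\<lambda>y. p f y $ k) \<in> borel_measurable DY" for k using p_measurable[OF assms] by simp
  from borel_measurable_PiM_component[OF this] show ?thesis
    by (intro borel_measurable_sum borel_measurable_times borel_measurable_const) auto
qed

lemma dev_measurable_fst: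
  "f \<in> F \<Longrightarrow> (\<lambda>\<omega>. \<Sum>i<n. m f - l f (fst \<omega> i)) \<in> borel_measurable (PiM {..<n} (\<lambda>_. D) \<Otimes>\<^sub>M M')"
  by (rule measurable_compose[OF measurable_fst dev_measurable])

lemma rad_measurable_fst:
  "f \<in> F \<Longrightarrow> (\<lambda>\<omega>. C * (\<Sum>i<n. \<Sum>k\<in>UNIV. \<sigma> (i, k) * p f (fst \<omega> i) $ k))
    \<in> borel_measurable (PiM {..<n} (\<lambda>_. DY) \<Otimes>\<^sub>M M')"
  by (rule measurable_compose[OF measurable_fst rad_measurable])

lemma shift_measurable:
  "f \<in> F \<Longrightarrow> (\<lambda>\<omega>. a f + C * (\<Sum>k\<in>UNIV. \<tau> k * p f (snd \<omega>) $ k)) \<in> borel_measurable (M' \<Otimes>\<^sub>M DY)"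
  by (rule borel_measurable_add[OF borel_measurable_const
        measurable_compose[OF measurable_snd signed_sum_measurable]])

lemma l_measurable_snd: "f \<in> F \<Longrightarrow> (\<lambda>\<omega>. l f (snd \<omega>)) \<in> borel_measurable (M' \<Otimes>\<^sub>M D)"
  by (rule measurable_compose[OF measurable_snd l])

lemma integrable_dev_sup:
  assumes a: "\<And>f. f \<in> F \<Longrightarrow> \<bar>a f\<bar> \<le> B"
  shows "integrable (PiM {..<n} (\<lambda>_. D)) (dev_sup n a)"
  unfolding dev_sup_def
  by (rule finite_measure.integrable_cSUP_add[OF prob_space.finite_measure[OF prob_space_samples(1)] F
        borel_measurable_const dev_measurable a dev_bound])

lemma integrable_rad_sup:
  assumes a: "\<And>f. f \<in> F \<Longrightarrow> \<bar>a f\<bar> \<le> B"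
  shows "integrable (PiM {..<n} (\<lambda>_. DY)) (\<lambda>x. sign_mean ({..<n} \<times> UNIV) (\<lambda>\<sigma>. rad_sup n a \<sigma> x))"
  unfolding rad_sup_def
proof (rule integrable_sign_mean)
  fix \<sigma> :: "nat \<times> 'k \<Rightarrow> real" assume \<sigma>: "\<sigma> \<in> set_pmf (sign_pmf ({..<n} \<times> UNIV))"
  show "integrable (PiM {..<n} (\<lambda>_. DY))
      (\<lambda>x. SUP f\<in>F. a f + C * (\<Sum>i<n. \<Sum>k\<in>UNIV. \<sigma> (i, k) * p f (x i) $ k))"
    by (rule finite_measure.integrable_cSUP_add[OF prob_space.finite_measure[OF prob_space_samples(2)] F
          borel_measurable_const rad_measurable a rad_bound[OF _ \<sigma>]])
qed simp

text \<open>Symmetrization followed by contraction; all other samples are hidden in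
  \<open>a\<close>.\<close>

lemma one_sample:
  assumes a: "\<And>f. f \<in> F \<Longrightarrow> \<bar>a f\<bar> \<le> B"
  shows "(\<integral>s. (SUP f\<in>F. a f + (m f - l f s)) \<partial>D)
    \<le> (\<integral>y. sign_mean UNIV (\<lambda>\<tau>. SUP f\<in>F. a f + C * (\<Sum>k\<in>UNIV. \<tau> k * p f y $ k)) \<partial>DY)"
proof -
  define R where "R y \<tau> = (SUP f\<in>F. a f + C * (\<Sum>k\<in>UNIV. \<tau> k * p f y $ k))" for y \<tau>
  have bnd: "\<bar>a f + C * (\<Sum>k\<in>UNIV. \<tau> k * p f y $ k)\<bar> \<le> B + C * real CARD('k)"
    if "f \<in> F" "\<tau> \<in> set_pmf (sign_pmf UNIV)" "y \<in> space Y" for f \<tau> y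
    using a[OF that(1)] signed_sum_bound[OF that] by linarith
  have R_int: "integrable D (\<lambda>s. R (g s) \<tau>)" if "\<tau> \<in> set_pmf (sign_pmf UNIV)" for \<tau>
    unfolding R_def using F bnd that measurable_space[OF g]
    by (intro integrable_cSUP[where B = "B + C * real CARD('k)"]) auto
  have R_int': "integrable DY (\<lambda>y. R y \<tau>)" if "\<tau> \<in> set_pmf (sign_pmf UNIV)" for \<tau>
    unfolding R_def using F bnd that
    by (intro finite_measure.integrable_cSUP[where B = "B + C * real CARD('k)"]
        prob_space.finite_measure prob_space_DY) auto
  have "(\<integral>s. (SUP f\<in>F. a f + (m f - l f s)) \<partial>D)
    \<le> (\<integral>s. ((SUP f\<in>F. a f + 2 * l f s) + (SUP f\<in>F. a f - 2 * l f s)) / 2 \<partial>D)"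
    using F a l l_bound by (rule symmetrization_step)
  also have "\<dots> \<le> (\<integral>s. sign_mean UNIV (R (g s)) \<partial>D)"
  proof (rule integral_mono)
    have bnd': "\<bar>a f + 2 * l f s\<bar> \<le> B + 2 * b" "\<bar>a f - 2 * l f s\<bar> \<le> B + 2 * b"
      if "f \<in> F" "s \<in> space D" for f s
      using a[OF that(1)] l_bound[OF that] by linarith+
    show "integrable D (\<lambda>s. ((SUP f\<in>F. a f + 2 * l f s) + (SUP f\<in>F. a f - 2 * l f s)) / 2)"
      using F bnd' by (intro integrable_divide Bochner_Integration.integrable_add
          integrable_cSUP[where B = "B + 2 * b"]) auto
    show "integrable D (\<lambda>s. sign_mean UNIV (R (g s)))"
      using R_int by (intro integrable_sign_mean) auto
    fix s assume s: "s \<in> space D"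
    \<comment> \<open>Contraction is applied to \<open>2 * l\<close>, whose Lipschitz constant is
      \<open>2 * L\<close>.\<close>
    have C_eq: "C = sqrt 2 * (2 * L)" by (simp add: C_def)
    have "\<bar>2 * l f s - 2 * l f' s\<bar> \<le> 2 * L * norm (p f (g s) - p f' (g s))"
      if "f \<in> F" "f' \<in> F" for f f'
      using l_lipschitz[OF that s] by linarith
    then show "((SUP f\<in>F. a f + 2 * l f s) + (SUP f\<in>F. a f - 2 * l f s)) / 2 \<le> sign_mean UNIV (R (g s))"
      unfolding R_def C_eq using F(1) a p_bound measurable_space[OF g s] L
      by (intro vector_contraction) auto
  qed
  \<comment> \<open>What is left depends on the data point through \<open>g\<close> alone.\<close>
  also have "\<dots> = (\<integral>y. sign_mean UNIV (R y) \<partial>DY)"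
  proof (rule integral_distr[symmetric])
    have "integrable DY (\<lambda>y. sign_mean UNIV (R y))"
      using R_int' by (intro integrable_sign_mean) auto
    then show "(\<lambda>y. sign_mean UNIV (R y)) \<in> borel_measurable Y" by simp
  qed measurable
  finally show ?thesis unfolding R_def .
qed

lemma rad_sup_Suc:
  "sign_mean ({..<Suc n} \<times> UNIV) (\<lambda>\<sigma>. rad_sup (Suc n) a \<sigma> (x(n := y)))
    = sign_mean UNIV (\<lambda>\<tau>. sign_mean ({..<n} \<times> UNIV)
        (\<lambda>\<sigma>. rad_sup n (\<lambda>f. a f + C * (\<Sum>k\<in>UNIV. \<tau> k * p f y $ k)) \<sigma> x))"
  unfolding sign_mean_Suc rad_sup_def by (simp add: algebra_simps)

lemma dev_sup_Suc:
  "dev_sup (Suc n) a (s(n := t)) = (SUP f\<in>F. (a f + (\<Sum>i<n. m f - l f (s i))) + (m f - l f t))"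
  unfolding dev_sup_def by (simp add: algebra_simps)

text \<open>A hybrid argument: \<open>one_sample\<close> exchanges the last sample, and its signed
  sum joins the offset to which the induction hypothesis for the first \<open>n\<close> samples is
  applied. This is why \<open>a\<close> and \<open>B\<close> are generalized.\<close>

lemma expectation_dev_sup_le:
  assumes "\<And>f. f \<in> F \<Longrightarrow> \<bar>a f\<bar> \<le> B"
  shows "(\<integral>s. dev_sup n a s \<partial>PiM {..<n} (\<lambda>_. D))
    \<le> (\<integral>x. sign_mean ({..<n} \<times> UNIV) (\<lambda>\<sigma>. rad_sup n a \<sigma> x) \<partial>PiM {..<n} (\<lambda>_. DY))"
  using assms
proof (induction n arbitrary: a B)
  case 0
  interpret D0: prob_space "PiM {} (\<lambda>_::nat. D)" by (rule prob_space_samples)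
  interpret Y0: prob_space "PiM {} (\<lambda>_::nat. DY)" by (rule prob_space_samples)
  have "(\<integral>s. (SUP f\<in>F. a f) \<partial>PiM {} (\<lambda>_::nat. D)) = (\<integral>x. (SUP f\<in>F. a f) \<partial>PiM {} (\<lambda>_::nat. DY))"
    using D0.prob_space Y0.prob_space by simp
  moreover have "sign_mean ({} :: (nat \<times> 'k) set) (\<lambda>_. SUP f\<in>F. a f) = (SUP f\<in>F. a f)" by simp
  ultimately show ?case by (simp add: dev_sup_def rad_sup_def del: lebesgue_integral_const)
next
  case (Suc n)
  note a = Suc.prems
  interpret DY: prob_space DY by (rule prob_space_DY)
  interpret Dn: prob_space "PiM {..<n} (\<lambda>_. D)" by (rule prob_space_samples)
  interpret Yn: prob_space "PiM {..<n} (\<lambda>_. DY)" by (rule prob_space_samples)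
  interpret PD: product_sigma_finite "\<lambda>_::nat. D"
    by unfold_locales
  interpret PY: product_sigma_finite "\<lambda>_::nat. DY"
    by unfold_locales
  interpret DnY: pair_prob_space "PiM {..<n} (\<lambda>_. D)" DY ..
  interpret YnY: pair_prob_space "PiM {..<n} (\<lambda>_. DY)" DY ..
  let ?a = "\<lambda>\<tau> y f. a f + C * (\<Sum>k\<in>UNIV. \<tau> k * p f y $ k)"
  have a': "\<bar>?a \<tau> y f\<bar> \<le> B + C * real CARD('k)"
    if "f \<in> F" "\<tau> \<in> set_pmf (sign_pmf UNIV)" "y \<in> space Y" for f \<tau> y
    using a[OF that(1)] signed_sum_bound[OF that] by linarith
  have int_pair: "integrable (PiM {..<n} (\<lambda>_. D) \<Otimes>\<^sub>M DY) (\<lambda>(s, y). dev_sup n (?a \<tau> y) s)"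
    if \<tau>: "\<tau> \<in> set_pmf (sign_pmf UNIV)" for \<tau>
    unfolding dev_sup_def case_prod_beta
    by (rule DnY.integrable_cSUP_add[OF F shift_measurable dev_measurable_fst a'[OF _ \<tau> space_pair_DY]
          dev_bound[OF _ space_pair_fst]])
  have int_pairY: "integrable (PiM {..<n} (\<lambda>_. DY) \<Otimes>\<^sub>M DY) (\<lambda>(x, y). rad_sup n (?a \<tau> y) \<sigma> x)"
    if \<tau>: "\<tau> \<in> set_pmf (sign_pmf UNIV)" and \<sigma>: "\<sigma> \<in> set_pmf (sign_pmf ({..<n} \<times> UNIV))" for \<tau> \<sigma>
    unfolding rad_sup_def case_prod_beta
    by (rule YnY.integrable_cSUP_add[OF F shift_measurable rad_measurable_fst a'[OF _ \<tau> space_pair_DY]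
          rad_bound[OF _ \<sigma> space_pair_fst]])
  have int_sign: "integrable (PiM {..<n} (\<lambda>_. D) \<Otimes>\<^sub>M DY)
      (\<lambda>(s, y). sign_mean UNIV (\<lambda>\<tau>. dev_sup n (?a \<tau> y) s))"
    unfolding case_prod_beta
    by (rule integrable_sign_mean[OF _ int_pair[unfolded case_prod_beta]]) simp_all
  have int_sign': "integrable (PiM {..<n} (\<lambda>_. DY) \<Otimes>\<^sub>M DY)
      (\<lambda>(x, y). sign_mean ({..<n} \<times> UNIV) (\<lambda>\<sigma>. rad_sup n (?a \<tau> y) \<sigma> x))"
    if "\<tau> \<in> set_pmf (sign_pmf UNIV)" for \<tau>
    unfolding case_prod_beta
    by (rule integrable_sign_mean[OF _ int_pairY[OF that, unfolded case_prod_beta]]) simp_all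
  have int_signY: "integrable (PiM {..<n} (\<lambda>_. DY) \<Otimes>\<^sub>M DY)
      (\<lambda>(x, y). sign_mean UNIV (\<lambda>\<tau>. sign_mean ({..<n} \<times> UNIV) (\<lambda>\<sigma>. rad_sup n (?a \<tau> y) \<sigma> x)))"
    unfolding case_prod_beta
    by (rule integrable_sign_mean[OF _ int_sign'[unfolded case_prod_beta]]) simp_all
  have ins: "{..<Suc n} = insert n {..<n}" by auto
  have int_Suc: "integrable (PiM (insert n {..<n}) (\<lambda>_. D)) (dev_sup (Suc n) a)"
    unfolding ins[symmetric] by (rule integrable_dev_sup[OF a])
  have int_SucY: "integrable (PiM (insert n {..<n}) (\<lambda>_. DY))
      (\<lambda>x. sign_mean ({..<Suc n} \<times> UNIV) (\<lambda>\<sigma>. rad_sup (Suc n) a \<sigma> x))"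
    unfolding ins[symmetric] by (rule integrable_rad_sup[OF a])
  have "(\<integral>s. dev_sup (Suc n) a s \<partial>PiM {..<Suc n} (\<lambda>_. D))
      = (\<integral>s. (\<integral>t. dev_sup (Suc n) a (s(n := t)) \<partial>D) \<partial>PiM {..<n} (\<lambda>_. D))"
    unfolding ins by (rule PD.product_integral_insert[OF _ _ int_Suc]) auto
  also have "\<dots> \<le> (\<integral>s. (\<integral>y. sign_mean UNIV (\<lambda>\<tau>. dev_sup n (?a \<tau> y) s) \<partial>DY) \<partial>PiM {..<n} (\<lambda>_. D))"
  proof (rule integral_mono)
    show "integrable (PiM {..<n} (\<lambda>_. D)) (\<lambda>s. \<integral>t. dev_sup (Suc n) a (s(n := t)) \<partial>D)"
    proof -
      interpret P: pair_prob_space "PiM {..<n} (\<lambda>_. D)" D ..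
      have "integrable (PiM {..<n} (\<lambda>_. D) \<Otimes>\<^sub>M D) (\<lambda>(s, t). dev_sup (Suc n) a (s(n := t)))"
        unfolding dev_sup_Suc case_prod_beta
      proof (rule P.integrable_cSUP_add[OF F])
        fix f assume f: "f \<in> F"
        show "(\<lambda>\<omega>. a f + (\<Sum>i<n. m f - l f (fst \<omega> i))) \<in> borel_measurable (PiM {..<n} (\<lambda>_. D) \<Otimes>\<^sub>M D)"
          by (rule borel_measurable_add[OF borel_measurable_const dev_measurable_fst[OF f]])
        show "(\<lambda>\<omega>. m f - l f (snd \<omega>)) \<in> borel_measurable (PiM {..<n} (\<lambda>_. D) \<Otimes>\<^sub>M D)"
          by (rule borel_measurable_diff[OF borel_measurable_const l_measurable_snd[OF f]])
        fix \<omega> assume \<omega>: "\<omega> \<in> space (PiM {..<n} (\<lambda>_. D) \<Otimes>\<^sub>M D)"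
        show "\<bar>a f + (\<Sum>i<n. m f - l f (fst \<omega> i))\<bar> \<le> B + real n * (2 * b)"
          by (rule order_trans[OF abs_triangle_ineq
                add_mono[OF a[OF f] dev_bound[OF f space_pair_fst[OF \<omega>]]]])
        show "\<bar>m f - l f (snd \<omega>)\<bar> \<le> b + b"
          by (rule order_trans[OF abs_triangle_ineq4
                add_mono[OF m_bound[OF f] l_bound[OF f space_pair_D[OF \<omega>]]]])
      qed
      then show ?thesis by (rule P.integrable_fst)
    qed
    show "integrable (PiM {..<n} (\<lambda>_. D)) (\<lambda>s. \<integral>y. sign_mean UNIV (\<lambda>\<tau>. dev_sup n (?a \<tau> y) s) \<partial>DY)"
      using int_sign by (rule DnY.integrable_fst)
    fix s assume s: "s \<in> space (PiM {..<n} (\<lambda>_. D))"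
    \<comment> \<open>The deviations of the first \<open>n\<close> samples, frozen at
      \<open>s\<close>, serve as the offset.\<close>
    have "\<bar>a f + (\<Sum>i<n. m f - l f (s i))\<bar> \<le> B + real n * (2 * b)" if "f \<in> F" for f
      using a[OF that] dev_bound[OF that s] by linarith
    from one_sample[where a = "\<lambda>f. a f + (\<Sum>i<n. m f - l f (s i))", OF this]
    show "(\<integral>t. dev_sup (Suc n) a (s(n := t)) \<partial>D)
        \<le> (\<integral>y. sign_mean UNIV (\<lambda>\<tau>. dev_sup n (?a \<tau> y) s) \<partial>DY)"
      unfolding dev_sup_Suc unfolding dev_sup_def by (simp add: ac_simps)
  qed
  \<comment> \<open>The new feature \<open>y\<close> moves outside, so that at fixed
    \<open>y\<close> and signs the offset is constant and the induction hypothesis applies.\<close>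
  also have "\<dots> = (\<integral>y. (\<integral>s. sign_mean UNIV (\<lambda>\<tau>. dev_sup n (?a \<tau> y) s) \<partial>PiM {..<n} (\<lambda>_. D)) \<partial>DY)"
    by (rule DnY.Fubini_integral[OF int_sign, symmetric])
  also have "\<dots> \<le> (\<integral>y. (\<integral>x. sign_mean UNIV (\<lambda>\<tau>. sign_mean ({..<n} \<times> UNIV)
        (\<lambda>\<sigma>. rad_sup n (?a \<tau> y) \<sigma> x)) \<partial>PiM {..<n} (\<lambda>_. DY)) \<partial>DY)"
  proof (rule integral_mono)
    show "integrable DY (\<lambda>y. \<integral>s. sign_mean UNIV (\<lambda>\<tau>. dev_sup n (?a \<tau> y) s) \<partial>PiM {..<n} (\<lambda>_. D))"
      using int_sign by (rule DnY.integrable_snd)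
    show "integrable DY (\<lambda>y. \<integral>x. sign_mean UNIV (\<lambda>\<tau>. sign_mean ({..<n} \<times> UNIV)
        (\<lambda>\<sigma>. rad_sup n (?a \<tau> y) \<sigma> x)) \<partial>PiM {..<n} (\<lambda>_. DY))"
      using int_signY by (rule YnY.integrable_snd)
    fix y assume "y \<in> space DY"
    then have y: "y \<in> space Y" by simp
    have "(\<integral>s. sign_mean UNIV (\<lambda>\<tau>. dev_sup n (?a \<tau> y) s) \<partial>PiM {..<n} (\<lambda>_. D))
        = sign_mean UNIV (\<lambda>\<tau>. \<integral>s. dev_sup n (?a \<tau> y) s \<partial>PiM {..<n} (\<lambda>_. D))"
      by (intro integral_sign_mean integrable_dev_sup[OF a'[OF _ _ y]]) auto
    also have "\<dots> \<le> sign_mean UNIV (\<lambda>\<tau>. \<integral>x. sign_mean ({..<n} \<times> UNIV)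
        (\<lambda>\<sigma>. rad_sup n (?a \<tau> y) \<sigma> x) \<partial>PiM {..<n} (\<lambda>_. DY))"
      by (intro sign_mean_mono Suc.IH[OF a'[OF _ _ y]]) auto
    also have "\<dots> = (\<integral>x. sign_mean UNIV (\<lambda>\<tau>. sign_mean ({..<n} \<times> UNIV)
        (\<lambda>\<sigma>. rad_sup n (?a \<tau> y) \<sigma> x)) \<partial>PiM {..<n} (\<lambda>_. DY))"
      by (intro integral_sign_mean[symmetric] integrable_rad_sup[OF a'[OF _ _ y]]) auto
    finally show "(\<integral>s. sign_mean UNIV (\<lambda>\<tau>. dev_sup n (?a \<tau> y) s) \<partial>PiM {..<n} (\<lambda>_. D))
      \<le> (\<integral>x. sign_mean UNIV (\<lambda>\<tau>. sign_mean ({..<n} \<times> UNIV)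
        (\<lambda>\<sigma>. rad_sup n (?a \<tau> y) \<sigma> x)) \<partial>PiM {..<n} (\<lambda>_. DY))" .
  qed
  \<comment> \<open>Back to the order in which the last coordinate is integrated first, as for the
    product measure.\<close>
  also have "\<dots> = (\<integral>x. (\<integral>y. sign_mean UNIV (\<lambda>\<tau>. sign_mean ({..<n} \<times> UNIV)
        (\<lambda>\<sigma>. rad_sup n (?a \<tau> y) \<sigma> x)) \<partial>DY) \<partial>PiM {..<n} (\<lambda>_. DY))"
    by (rule YnY.Fubini_integral[OF int_signY])
  also have "\<dots> = (\<integral>x. (\<integral>y. sign_mean ({..<Suc n} \<times> UNIV)
        (\<lambda>\<sigma>. rad_sup (Suc n) a \<sigma> (x(n := y))) \<partial>DY) \<partial>PiM {..<n} (\<lambda>_. DY))"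
    by (simp only: rad_sup_Suc)
  also have "\<dots> = (\<integral>x. sign_mean ({..<Suc n} \<times> UNIV) (\<lambda>\<sigma>. rad_sup (Suc n) a \<sigma> x) \<partial>PiM {..<Suc n} (\<lambda>_. DY))"
    unfolding ins by (rule PY.product_integral_insert[OF _ _ int_SucY[unfolded ins], symmetric]) auto
  finally show ?case .
qed

section \<open>Concentration of the uniform deviation\<close>

lemma bound_nonneg: "0 \<le> b"
proof -
  obtain f s where "f \<in> F" "s \<in> space D" using F(1) not_empty by auto
  from l_bound[OF this] show ?thesis by linarith
qed

lemma dev_sup_ge:
  assumes "f \<in> F" "s \<in> space (PiM {..<n} (\<lambda>_. D))"
  shows "(\<Sum>i<n. m f - l f (s i)) \<le> dev_sup n (\<lambda>_. 0) s"
  unfolding dev_sup_def add_0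
  by (rule cSUP_upper[OF assms(1) bdd_above_abs_le[OF dev_bound[OF _ assms(2)]]])

lemma abs_dev_sup_le:
  assumes "s \<in> space (PiM {..<n} (\<lambda>_. D))"
  shows "\<bar>dev_sup n (\<lambda>_. 0) s\<bar> \<le> real n * (2 * b)"
  unfolding dev_sup_def add_0 by (rule abs_cSUP_le[OF F(1) dev_bound[OF _ assms]])

text \<open>Each loss lies between 0 and \<open>b\<close>, so exchanging one point raises every
  deviation sum by at most \<open>b\<close>. Nonnegativity is what gives \<open>b\<close> here
  instead of \<open>2 * b\<close>.\<close>

lemma dev_sup_bounded_differences:
  assumes nonneg: "\<And>f s. f \<in> F \<Longrightarrow> s \<in> space D \<Longrightarrow> 0 \<le> l f s"
    and s: "s \<in> space (PiM {..<n} (\<lambda>_. D))" and i: "i < n" and t: "t \<in> space D"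
  shows "dev_sup n (\<lambda>_. 0) (s(i := t)) - dev_sup n (\<lambda>_. 0) s \<le> b"
proof -
  have "(\<Sum>j<n. m f - l f ((s(i := t)) j)) \<le> dev_sup n (\<lambda>_. 0) s + b" if f: "f \<in> F" for f
  proof -
    have "(\<Sum>j<n. m f - l f ((s(i := t)) j))
        = (\<Sum>j<n. (m f - l f (s j)) + (if j = i then l f (s i) - l f t else 0))"
      by (intro sum.cong) auto
    also have "\<dots> = (\<Sum>j<n. m f - l f (s j)) + (l f (s i) - l f t)"
      using i by (simp add: sum.distrib)
    also have "\<dots> \<le> dev_sup n (\<lambda>_. 0) s + b"
      using dev_sup_ge[OF f s] nonneg[OF f t] l_bound[OF f space_PiM_D[OF s i]] by linarith
    finally show ?thesis .
  qed
  then have "dev_sup n (\<lambda>_. 0) (s(i := t)) \<le> dev_sup n (\<lambda>_. 0) s + b"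
    unfolding dev_sup_def[of n _ "s(i := t)"] add_0 by (rule cSUP_least[OF F(1)])
  then show ?thesis by simp
qed

lemma dev_sup_tail:
  assumes nonneg: "\<And>f s. f \<in> F \<Longrightarrow> s \<in> space D \<Longrightarrow> 0 \<le> l f s"
    and n: "0 < n" and \<delta>: "0 < \<delta>" "\<delta> \<le> 1"
  shows "\<P>(s in PiM {..<n} (\<lambda>_. D). (\<integral>s. dev_sup n (\<lambda>_. 0) s \<partial>PiM {..<n} (\<lambda>_. D))
      + real n * b * sqrt (ln (1 / \<delta>) / (2 * real n)) < dev_sup n (\<lambda>_. 0) s) \<le> \<delta>"
proof (cases "b = 0")
  \<comment> \<open>\<open>mcdiarmid\<close> needs a positive difference bound; for
    \<open>b = 0\<close> the deviation vanishes identically.\<close>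
  case True
  then have dev0: "dev_sup n (\<lambda>_. 0) s = 0" if "s \<in> space (PiM {..<n} (\<lambda>_. D))" for s
    using abs_dev_sup_le[OF that] by simp
  then have "(\<integral>s. dev_sup n (\<lambda>_. 0) s \<partial>PiM {..<n} (\<lambda>_. D)) = (\<integral>s. 0 \<partial>PiM {..<n} (\<lambda>_. D))"
    by (intro Bochner_Integration.integral_cong refl)
  moreover have "{s \<in> space (PiM {..<n} (\<lambda>_. D)). 0 < dev_sup n (\<lambda>_. 0) s} = {}"
    using dev0 by auto
  then have "\<P>(s in PiM {..<n} (\<lambda>_. D). 0 < dev_sup n (\<lambda>_. 0) s) = 0"
    by (simp only: measure_empty)
  ultimately show ?thesis using True \<delta> by simp
next
  case False
  then have b: "0 < b" using bound_nonneg by simp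
  let ?\<epsilon> = "real n * b * sqrt (ln (1 / \<delta>) / (2 * real n))"
  have ln: "0 \<le> ln (1 / \<delta>)" using \<delta> by simp
  have "?\<epsilon>\<^sup>2 = (real n)\<^sup>2 * b\<^sup>2 * (ln (1 / \<delta>) / (2 * real n))"
    using ln by (simp add: power_mult_distrib)
  \<comment> \<open>\<open>?\<epsilon>\<close> is chosen to make the tail exactly
    \<open>\<delta>\<close>.\<close>
  then have exponent: "- 2 * ?\<epsilon>\<^sup>2 / (real n * b\<^sup>2) = - ln (1 / \<delta>)"
    using n b by (simp add: power2_eq_square field_simps)
  have "\<P>(s in PiM {..<n} (\<lambda>_. D). (\<integral>s. dev_sup n (\<lambda>_. 0) s \<partial>PiM {..<n} (\<lambda>_. D)) + ?\<epsilon>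
      < dev_sup n (\<lambda>_. 0) s) \<le> exp (- 2 * ?\<epsilon>\<^sup>2 / (real n * b\<^sup>2))"
  proof (rule mcdiarmid)
    show "dev_sup n (\<lambda>_. 0) \<in> borel_measurable (PiM {..<n} (\<lambda>_. D))"
      using integrable_dev_sup[of "\<lambda>_. 0" 0 n] by (intro borel_measurable_integrable) auto
    show "0 \<le> ?\<epsilon>" using ln b by simp
  qed (use abs_dev_sup_le dev_sup_bounded_differences[OF nonneg] b n in auto)
  also have "\<dots> = \<delta>"
    unfolding exponent using \<delta> by (simp add: ln_div)
  finally show ?thesis .
qed

end

text \<open>Passing from \<open>F\<close> to the larger class \<open>H\<close> can only increase the
  supremum. \<open>H\<close> may be uncountable, so integrability of its complexity is taken from
  \<open>bounded_rademacher\<close>. The factor is \<open>C\<close> divided by the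
  \<open>2 / real n\<close> of \<open>empirical_rademacher\<close>.\<close>

lemma (in lipschitz_loss_class) expectation_dev_sup_le_rademacher:
  assumes sub: "p ` F \<subseteq> H"
    and H_bound: "\<And>h y k. h \<in> H \<Longrightarrow> y \<in> space Y \<Longrightarrow> \<bar>h y $ k\<bar> \<le> 1"
    and H_int: "bounded_rademacher DY n H" and n: "0 < n"
  shows "(\<integral>s. dev_sup n (\<lambda>_. 0) s \<partial>PiM {..<n} (\<lambda>_. D)) \<le> real n * (sqrt 2 * L) * rademacher DY n H"
proof -
  have "(\<integral>s. dev_sup n (\<lambda>_. 0) s \<partial>PiM {..<n} (\<lambda>_. D))
      \<le> (\<integral>x. sign_mean ({..<n} \<times> UNIV) (\<lambda>\<sigma>. rad_sup n (\<lambda>_. 0) \<sigma> x) \<partial>PiM {..<n} (\<lambda>_. DY))"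
    by (rule expectation_dev_sup_le[where B = 0]) simp
  also have "\<dots> \<le> (\<integral>x. real n * (sqrt 2 * L) * empirical_rademacher n H x \<partial>PiM {..<n} (\<lambda>_. DY))"
  proof (rule integral_mono)
    show "integrable (PiM {..<n} (\<lambda>_. DY)) (\<lambda>x. sign_mean ({..<n} \<times> UNIV) (\<lambda>\<sigma>. rad_sup n (\<lambda>_. 0) \<sigma> x))"
      by (rule integrable_rad_sup[where B = 0]) simp
    show "integrable (PiM {..<n} (\<lambda>_. DY)) (\<lambda>x. real n * (sqrt 2 * L) * empirical_rademacher n H x)"
      using H_int unfolding bounded_rademacher_def iid_def by (rule integrable_mult_right)
    fix x assume x: "x \<in> space (PiM {..<n} (\<lambda>_. DY))"
    let ?X = "\<lambda>\<sigma> h. \<Sum>i<n. \<Sum>k\<in>UNIV. \<sigma> (i, k) * h (x i) $ k"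
    have "rad_sup n (\<lambda>_. 0) \<sigma> x \<le> real n * (sqrt 2 * L) * (2 / real n * (SUP h\<in>H. ?X \<sigma> h))"
      if \<sigma>: "\<sigma> \<in> set_pmf (sign_pmf ({..<n} \<times> UNIV))" for \<sigma>
    proof -
      have "\<bar>?X \<sigma> h\<bar> \<le> real (card ({..<n} \<times> (UNIV :: 'k set)))" if "h \<in> H" for h
      proof -
        have "?X \<sigma> h = (\<Sum>j\<in>{..<n} \<times> UNIV. \<sigma> j * (h (x (fst j)) $ snd j))"
          by (simp add: sum.cartesian_product case_prod_beta)
        also have "\<bar>\<dots>\<bar> \<le> real (card ({..<n} \<times> (UNIV :: 'k set)))"
          using \<sigma> H_bound[OF that] space_PiM_DY[OF x]
          by (intro abs_signed_sum_le[where A = "{..<n} \<times> UNIV"]) auto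
        finally show ?thesis .
      qed
      then have bdd: "bdd_above (?X \<sigma> ` H)" by (rule bdd_above_abs_le)
      have "rad_sup n (\<lambda>_. 0) \<sigma> x \<le> C * (SUP h\<in>H. ?X \<sigma> h)"
        unfolding rad_sup_def add_0
      proof (rule cSUP_least[OF F(1)])
        fix f assume f: "f \<in> F"
        then have "?X \<sigma> (p f) \<le> (SUP h\<in>H. ?X \<sigma> h)"
          using sub by (intro cSUP_upper bdd) auto
        then show "C * (\<Sum>i<n. \<Sum>k\<in>UNIV. \<sigma> (i, k) * p f (x i) $ k) \<le> C * (SUP h\<in>H. ?X \<sigma> h)"
          using C_nonneg by (simp add: mult_left_mono)
      qed
      also have "\<dots> = real n * (sqrt 2 * L) * (2 / real n * (SUP h\<in>H. ?X \<sigma> h))"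
        using n by (simp add: C_def)
      finally show ?thesis .
    qed
    then have "sign_mean ({..<n} \<times> UNIV) (\<lambda>\<sigma>. rad_sup n (\<lambda>_. 0) \<sigma> x)
        \<le> sign_mean ({..<n} \<times> UNIV) (\<lambda>\<sigma>. real n * (sqrt 2 * L) * (2 / real n * (SUP h\<in>H. ?X \<sigma> h)))"
      by (intro sign_mean_mono) auto
    also have "\<dots> = real n * (sqrt 2 * L) * empirical_rademacher n H x"
      unfolding empirical_rademacher_def rademacher_signs_def sign_pmf_def
      by (rule integral_mult_right_zero)
    finally show "sign_mean ({..<n} \<times> UNIV) (\<lambda>\<sigma>. rad_sup n (\<lambda>_. 0) \<sigma> x)
        \<le> real n * (sqrt 2 * L) * empirical_rademacher n H x" .
  qed
  also have "\<dots> = real n * (sqrt 2 * L) * rademacher DY n H"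
    unfolding rademacher_def iid_def by (rule integral_mult_right_zero)
  finally show ?thesis .
qed

section \<open>Stability of the regularized minimizer\<close>

text \<open>Expansion in the axis vectors gives \<open>K\<close> as the sum of their
  \<open>N\<close>-values. This turns Lipschitz continuity for \<open>N\<close> into continuity for
  the standard topology.\<close>

lemma is_norm_le_norm:
  fixes N :: "real ^ 'd \<Rightarrow> real"
  assumes N: "is_norm N"
  obtains K where "0 \<le> K" "\<And>x. N x \<le> K * norm x"
proof
  let ?K = "\<Sum>i\<in>UNIV. N (axis i 1)"
  show "0 \<le> ?K" using N by (simp add: is_norm_def sum_nonneg)
  fix x :: "real ^ 'd"
  have N0: "N 0 = 0" and tri: "N (u + v) \<le> N u + N v" and hom: "N (r *\<^sub>R u) = \<bar>r\<bar> * N u"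
    and nonneg: "0 \<le> N u" for u v r
    using N by (simp_all add: is_norm_def)
  have sum_le: "N (\<Sum>i\<in>A. g i) \<le> (\<Sum>i\<in>A. N (g i))" if "finite A" for A and g :: "'d \<Rightarrow> real ^ 'd"
    using that
  proof (induction A rule: finite_induct)
    case (insert i A)
    then show ?case using tri[of "g i" "\<Sum>i\<in>A. g i"] by simp
  qed (simp add: N0)
  have "x = (\<Sum>i\<in>UNIV. x $ i *\<^sub>R axis i 1)"
    using basis_expansion[of x] by (simp add: scalar_mult_eq_scaleR)
  then have "N x \<le> (\<Sum>i\<in>UNIV. \<bar>x $ i\<bar> * N (axis i 1))"
    using sum_le[of UNIV "\<lambda>i. x $ i *\<^sub>R axis i 1"] by (simp add: hom)
  also have "\<dots> \<le> (\<Sum>i\<in>UNIV. norm x * N (axis i 1))"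
    by (intro sum_mono mult_right_mono component_le_norm_cart nonneg)
  finally show "N x \<le> ?K * norm x" by (simp add: sum_distrib_left mult.commute)
qed

lemma continuous_on_cost_vec:
  fixes S :: "(real ^ 'd) set" and z :: "'k::finite \<Rightarrow> 'z"
  assumes N: "is_norm N"
    and lip: "\<And>v w. v \<in> S \<Longrightarrow> w \<in> S \<Longrightarrow> norm (cost_vec c z v - cost_vec c z w) \<le> L * N (v - w)"
  shows "continuous_on S (cost_vec c z)"
proof -
  obtain K where K: "0 \<le> K" "\<And>x. N x \<le> K * norm x" using is_norm_le_norm[OF N] by blast
  \<comment> \<open>The absolute value is there because no sign of \<open>L\<close> is
    assumed.\<close>
  have "(\<bar>L\<bar> * K)-lipschitz_on S (cost_vec c z)"
  proof (rule lipschitz_onI)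
    fix v w assume vw: "v \<in> S" "w \<in> S"
    have "0 \<le> N (v - w)" using N by (simp add: is_norm_def)
    then have "L * N (v - w) \<le> \<bar>L\<bar> * N (v - w)" by (simp add: mult_right_mono)
    also have "\<dots> \<le> \<bar>L\<bar> * (K * norm (v - w))" using K by (simp add: mult_left_mono)
    finally show "dist (cost_vec c z v) (cost_vec c z w) \<le> \<bar>L\<bar> * K * dist v w"
      using lip[OF vw] by (simp add: dist_norm mult.assoc)
  qed (use K in simp)
  then show ?thesis by (rule lipschitz_on_continuous_on)
qed

text \<open>\<open>arg_min_on\<close> is a choice that means something only once a minimizer exists;
  compactness and continuity provide one.\<close>

lemma w_opt_minimizes:
  fixes S :: "(real ^ 'd) set" and z :: "'k::finite \<Rightarrow> 'z"
  assumes S: "S \<noteq> {}" "compact S"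
    and cont: "continuous_on S (cost_vec c z)" "continuous_on S \<phi>"
  shows "w_opt S c z \<phi> \<rho> p \<in> S"
    and "w \<in> S \<Longrightarrow> p \<bullet> cost_vec c z (w_opt S c z \<phi> \<rho> p) + \<rho> * \<phi> (w_opt S c z \<phi> \<rho> p)
      \<le> p \<bullet> cost_vec c z w + \<rho> * \<phi> w"
proof -
  define J where "J w = (\<Sum>k\<in>UNIV. p $ k * cost_vec c z w $ k) + \<rho> * \<phi> w" for w
  have J: "J w = p \<bullet> cost_vec c z w + \<rho> * \<phi> w" for w
    by (simp add: J_def inner_vec_def)
  have "continuous_on S J"
    unfolding J by (intro continuous_intros cont)
  then obtain w0 where "w0 \<in> S" "\<And>w. w \<in> S \<Longrightarrow> J w0 \<le> J w"
    using continuous_attains_inf[OF S(2,1)] by blast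
  then have "is_arg_min J (\<lambda>w. w \<in> S) w0"
    by (auto simp: is_arg_min_linorder)
  then have "is_arg_min J (\<lambda>w. w \<in> S) (w_opt S c z \<phi> \<rho> p)"
    unfolding w_opt_def J_def arg_min_on_def arg_min_def by (rule someI)
  then show "w_opt S c z \<phi> \<rho> p \<in> S"
    and "w \<in> S \<Longrightarrow> p \<bullet> cost_vec c z (w_opt S c z \<phi> \<rho> p) + \<rho> * \<phi> (w_opt S c z \<phi> \<rho> p)
      \<le> p \<bullet> cost_vec c z w + \<rho> * \<phi> w"
    by (auto simp: is_arg_min_linorder J)
qed

text \<open>Compare \<open>v\<close> with a point at fraction \<open>t\<close> of the way to
  \<open>w\<close>, divide by \<open>t\<close>, and let \<open>t\<close> tend to 0.\<close>

lemma strongly_convex_minimizer_growth: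
  assumes S: "convex S" and G: "convex_on S G" and \<phi>: "strongly_convex_wrt N 1 S \<phi>" and \<rho>: "0 \<le> \<rho>"
    and v: "v \<in> S" "\<And>u. u \<in> S \<Longrightarrow> G v + \<rho> * \<phi> v \<le> G u + \<rho> * \<phi> u" and w: "w \<in> S"
  shows "\<rho> / 2 * (N (w - v))\<^sup>2 \<le> (G w + \<rho> * \<phi> w) - (G v + \<rho> * \<phi> v)"
\<comment> \<open>This rule stands in for the limit: the inequality is shown with a factor
  \<open>r = 1 - t\<close> for every \<open>r\<close> strictly between 0 and 1.\<close>
proof (rule field_le_mult_one_interval)
  fix r :: real assume r: "0 < r" "r < 1"
  let ?t = "1 - r" and ?J = "\<lambda>u. G u + \<rho> * \<phi> u"
  let ?u = "?t *\<^sub>R w + (1 - ?t) *\<^sub>R v"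
  have t: "0 < ?t" "?t \<le> 1" using r by auto
  have "?u \<in> S" using convexD[OF S w v(1), of ?t "1 - ?t"] r by simp
  then have "?J v \<le> ?J ?u" by (rule v(2))
  moreover have "G ?u \<le> ?t * G w + (1 - ?t) * G v"
    using convex_onD[OF G, of r w v] w v(1) r by simp
  moreover have "\<rho> * \<phi> ?u \<le> \<rho> * (?t * \<phi> w + (1 - ?t) * \<phi> v - 1 / 2 * ?t * (1 - ?t) * (N (w - v))\<^sup>2)"
    using \<phi>[unfolded strongly_convex_wrt_def, rule_format, OF w v(1), of ?t] r \<rho>
    by (intro mult_left_mono) auto
  ultimately have "?t * (r * (\<rho> / 2 * (N (w - v))\<^sup>2)) \<le> ?t * (?J w - ?J v)"
    by (simp add: algebra_simps)
  then show "r * (\<rho> / 2 * (N (w - v))\<^sup>2) \<le> ?J w - ?J v" using t by simp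
qed

text \<open>Adding the growth inequalities at the two minimizers leaves
  \<open>\<rho> N(v - w)\<^sup>2 \<le> (p - q) \<bullet> (c w - c v)\<close>.\<close>

lemma cost_vec_w_opt_lipschitz:
  fixes S :: "(real ^ 'd) set" and z :: "'k::finite \<Rightarrow> 'z"
  assumes S: "S \<noteq> {}" "convex S" "compact S" and N: "is_norm N"
    and c_convex: "\<And>k. convex_on S (\<lambda>w. c w (z k))"
    and lip: "\<And>v w. v \<in> S \<Longrightarrow> w \<in> S \<Longrightarrow> norm (cost_vec c z v - cost_vec c z w) \<le> L * N (v - w)"
    and \<phi>: "continuous_on S \<phi>" "strongly_convex_wrt N 1 S \<phi>" and \<rho>: "0 < \<rho>"
    and p: "p \<in> prob_simplex" and q: "q \<in> prob_simplex"
  shows "norm (cost_vec c z (w_opt S c z \<phi> \<rho> p) - cost_vec c z (w_opt S c z \<phi> \<rho> q))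
    \<le> L\<^sup>2 / \<rho> * norm (p - q)"
proof -
  let ?C = "cost_vec c z" and ?v = "w_opt S c z \<phi> \<rho> p" and ?w = "w_opt S c z \<phi> \<rho> q"
  let ?n = "N (?v - ?w)"
  have cont: "continuous_on S ?C" using N lip by (rule continuous_on_cost_vec)
  note min = w_opt_minimizes[OF S(1,3) cont \<phi>(1), where \<rho> = \<rho>]
  have v: "?v \<in> S" and w: "?w \<in> S" by (rule min(1))+
  have conv: "convex_on S (\<lambda>u. r \<bullet> ?C u)" if "r \<in> prob_simplex" for r
  proof -
    have "convex_on S (\<lambda>u. \<Sum>k\<in>A. r $ k * c u (z k))" if "finite A" for A
      using that
    proof (induction A rule: finite_induct)
      case empty
      then show ?case using S(2) by (simp add: convex_on_const)
    next
      case (insert k A)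
      have "convex_on S (\<lambda>u. r $ k * c u (z k))"
        using \<open>r \<in> prob_simplex\<close> c_convex by (intro convex_on_cmul) (auto simp: prob_simplex_def)
      then show ?case using insert by (simp add: convex_on_add)
    qed
    then show ?thesis by (simp add: inner_vec_def cost_vec_def)
  qed
  have n: "0 \<le> ?n" "N (?w - ?v) = ?n"
    using N unfolding is_norm_def by (simp, metis abs_minus_cancel abs_one minus_diff_eq mult_1 scaleR_minus1_left)
  have "\<rho> / 2 * ?n\<^sup>2 \<le> (p \<bullet> ?C ?w + \<rho> * \<phi> ?w) - (p \<bullet> ?C ?v + \<rho> * \<phi> ?v)"
    using strongly_convex_minimizer_growth[OF S(2) conv[OF p] \<phi>(2) _ v min(2) w] \<rho> n(2) by simp
  moreover have "\<rho> / 2 * ?n\<^sup>2 \<le> (q \<bullet> ?C ?v + \<rho> * \<phi> ?v) - (q \<bullet> ?C ?w + \<rho> * \<phi> ?w)"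
    using strongly_convex_minimizer_growth[OF S(2) conv[OF q] \<phi>(2) _ w min(2) v] \<rho> by simp
  ultimately have "\<rho> * ?n\<^sup>2 \<le> (p - q) \<bullet> (?C ?w - ?C ?v)"
    by (simp add: inner_diff_left inner_diff_right)
  also have "\<dots> \<le> norm (p - q) * norm (?C ?v - ?C ?w)"
    using norm_cauchy_schwarz[of "p - q" "?C ?w - ?C ?v"] by (simp add: norm_minus_commute)
  also have "\<dots> \<le> norm (p - q) * (L * ?n)"
    using lip[OF v w] by (intro mult_left_mono) auto
  finally have *: "?n * (\<rho> * ?n) \<le> ?n * (L * norm (p - q))"
    by (simp add: power2_eq_square algebra_simps)
  \<comment> \<open>The inequality \<open>*\<close> must be divided by \<open>?n\<close>; if
    \<open>?n\<close> is 0, the two cost vectors coincide by \<open>lip\<close>.\<close>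
  show ?thesis
  proof (cases "?n = 0")
    case True
    then have "norm (?C ?v - ?C ?w) \<le> 0" using lip[OF v w] by simp
    then show ?thesis using \<rho> by (smt (verit) divide_nonneg_pos mult_nonneg_nonneg norm_ge_zero zero_le_power2)
  next
    case False
    then have npos: "0 < ?n" using n by simp
    then have n_le: "?n \<le> L * norm (p - q) / \<rho>" using * \<rho> by (simp add: field_simps)
    \<comment> \<open>The sign of \<open>L\<close> follows from \<open>lip\<close> at two distinct
      points.\<close>
    have "0 \<le> L * ?n" using lip[OF v w] norm_ge_zero order_trans by blast
    then have "0 \<le> L" using npos by (simp add: zero_le_mult_iff)
    then have "L * ?n \<le> L * (L * norm (p - q) / \<rho>)" using n_le by (rule mult_left_mono[rotated])
    then show ?thesis using lip[OF v w] by (simp add: power2_eq_square)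
  qed
qed

section \<open>The generalization bound\<close>

lemma prob_simplex_component_le:
  assumes "p \<in> prob_simplex"
  shows "\<bar>p $ k\<bar> \<le> 1"
proof -
  have sum: "(\<Sum>j\<in>UNIV. p $ j) = 1" and nn: "0 \<le> p $ j" for j
    using assms by (auto simp: prob_simplex_def)
  have "p $ k \<le> (\<Sum>j\<in>UNIV. p $ j)"
    by (rule member_le_sum) (auto simp: nn)
  then show ?thesis using nn[of k] sum by simp
qed

text \<open>Compactness bounds the costs; without boundedness the supremum in
  \<open>cost_bound\<close> would be an unspecified value.\<close>

lemma abs_cost_le_cost_bound:
  fixes S :: "'v::topological_space set" and z :: "'k::finite \<Rightarrow> 'z"
  assumes "compact S" "continuous_on S (cost_vec c z)" and w: "w \<in> S"
  shows "\<bar>c w (z k)\<bar> \<le> cost_bound S (range z) c"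
proof -
  have "bounded (cost_vec c z ` S)"
    using compact_continuous_image[OF assms(2,1)] by (rule compact_imp_bounded)
  then obtain B where B: "\<And>v. v \<in> S \<Longrightarrow> norm (cost_vec c z v) \<le> B"
    by (auto simp: bounded_iff)
  have "\<bar>c v (z j)\<bar> \<le> B" if "v \<in> S" for v j
    using component_le_norm_cart[of "cost_vec c z v" j] B[OF that] by (simp add: cost_vec_def)
  then have "bdd_above ((\<lambda>(v, \<xi>). \<bar>c v \<xi>\<bar>) ` (S \<times> range z))"
    by (intro bdd_aboveI[where M = B]) auto
  then have "(\<lambda>(v, \<xi>). \<bar>c v \<xi>\<bar>) (w, z k) \<le> (SUP (v, \<xi>)\<in>S \<times> range z. \<bar>c v \<xi>\<bar>)"
    using w by (intro cSUP_upper) auto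
  then show ?thesis by (simp add: cost_bound_def)
qed

text \<open>Write the function as a finite sum over the scenarios; by injectivity of
  \<open>z\<close> exactly one indicator is 1 at each point.\<close>

lemma borel_measurable_pair_count_space:
  fixes h :: "'x \<Rightarrow> 'z \<Rightarrow> real" and z :: "'k::finite \<Rightarrow> 'z"
  assumes z: "inj z" and h: "\<And>k. (\<lambda>x. h x (z k)) \<in> borel_measurable M"
  shows "(\<lambda>(x, \<xi>). h x \<xi>) \<in> borel_measurable (M \<Otimes>\<^sub>M count_space (range z))"
proof -
  have "(\<lambda>s. \<Sum>k\<in>UNIV. h (fst s) (z k) * indicator {z k} (snd s)) \<in> borel_measurable (M \<Otimes>\<^sub>M count_space (range z))"
    by (intro borel_measurable_sum borel_measurable_times measurable_compose[OF measurable_fst h]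
        measurable_compose[OF measurable_snd]) simp
  moreover have "(\<Sum>k\<in>UNIV. h (fst s) (z k) * indicator {z k} (snd s)) = (case s of (x, \<xi>) \<Rightarrow> h x \<xi>)"
    if s: "s \<in> space (M \<Otimes>\<^sub>M count_space (range z))" for s
  proof -
    obtain x j where sj: "s = (x, z j)" using s by (auto simp: space_pair_measure)
    have "(\<Sum>k\<in>UNIV. h x (z k) * indicator {z k} (z j)) = (\<Sum>k\<in>UNIV. if k = j then h x (z k) else 0)"
      using z by (intro sum.cong) (auto simp: indicator_def inj_eq)
    then show ?thesis by (simp add: sj)
  qed
  ultimately show ?thesis by (simp cong: measurable_cong)
qed

theorem theorem3:
  fixes S :: "(real ^ 'd) set"
    and N :: "real ^ 'd \<Rightarrow> real"
    and X :: "(real ^ 'p) set"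
    and z :: "'k::finite \<Rightarrow> 'z"
    and D :: "((real ^ 'p) \<times> 'z) measure"
    and Dx :: "(real ^ 'p) measure"
    and c :: "real ^ 'd \<Rightarrow> 'z \<Rightarrow> real"
    and \<phi> :: "real ^ 'd \<Rightarrow> real"
    and H :: "(real ^ 'p \<Rightarrow> real ^ 'k) set"
    and L\<^sub>c \<delta> \<rho> :: real
    and n :: nat
  assumes S: "S \<noteq> {}" "convex S" "compact S"
    and N: "is_norm N"
    and z: "inj z"
    and D: "prob_space D" "sets D = sets (restrict_space borel X \<Otimes>\<^sub>M count_space (range z))"
    and Dx: "Dx = distr D (restrict_space borel X) fst"
    and c_convex: "\<And>k. convex_on S (\<lambda>w. c w (z k))"
    and c_nonneg: "\<And>w k. w \<in> S \<Longrightarrow> 0 \<le> c w (z k)"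
    and c_lipschitz: "\<And>w\<^sub>1 w\<^sub>2. w\<^sub>1 \<in> S \<Longrightarrow> w\<^sub>2 \<in> S \<Longrightarrow>
          norm (cost_vec c z w\<^sub>1 - cost_vec c z w\<^sub>2) \<le> L\<^sub>c * N (w\<^sub>1 - w\<^sub>2)"
    and \<phi>: "\<And>w. w \<in> S \<Longrightarrow> 0 \<le> \<phi> w" "continuous_on S \<phi>" "strongly_convex_wrt N 1 S \<phi>"
    and H_simplex: "\<And>f x. f \<in> H \<Longrightarrow> x \<in> X \<Longrightarrow> f x \<in> prob_simplex"
    and H_measurable: "pointwise_measurable_class (restrict_space borel X) H"
    and H_rademacher: "bounded_rademacher Dx n H"
    and n: "n > 0"
    and \<delta>: "0 < \<delta>" "\<delta> \<le> 1"
    and \<rho>: "\<rho> > 0"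
  shows "\<P>(s in iid n D. \<forall>f\<in>H.
           risk D c (w_opt S c z \<phi> \<rho> \<circ> f)
             \<le> empirical_risk n s c (w_opt S c z \<phi> \<rho> \<circ> f)
               + sqrt 2 * L\<^sub>c\<^sup>2 / \<rho> * rademacher Dx n H
               + cost_bound S (range z) c * sqrt (ln (1 / \<delta>) / (2 * real n)))
         \<ge> 1 - \<delta>"
proof (cases "H = {}")
  interpret D: prob_space D by (rule D(1))
  interpret Dn: prob_space "iid n D"
    unfolding iid_def by (intro prob_space_PiM D(1))
  \<comment> \<open>The event is the whole space. The locale used below needs a nonempty
    class.\<close>
  case True
  then show ?thesis using \<delta> by (simp add: Dn.prob_space)
next
  case False
  interpret D: prob_space D by (rule D(1))
  interpret Dn: prob_space "PiM {..<n} (\<lambda>_. D)"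
    by (intro prob_space_PiM D(1))
  let ?w = "w_opt S c z \<phi> \<rho>" and ?Y = "restrict_space borel X" and ?b = "cost_bound S (range z) c"
  define K where "K = L\<^sub>c\<^sup>2 / \<rho>"
  define loss where "loss f s = c (?w (f (fst s))) (snd s)" for f :: "real ^ 'p \<Rightarrow> real ^ 'k" and s
  have K: "0 \<le> K" using \<rho> by (simp add: K_def)
  have space_Y: "space ?Y = X" by (simp add: space_restrict_space)
  have space_D: "space D = X \<times> range z"
    using sets_eq_imp_space_eq[OF D(2)] by (simp add: space_pair_measure space_Y)
  have cost_cont: "continuous_on S (cost_vec c z)"
    using N c_lipschitz by (rule continuous_on_cost_vec)
  have w_in: "?w q \<in> S" for q
    by (rule w_opt_minimizes(1)[OF S(1,3) cost_cont \<phi>(2)])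
  have cost_le: "\<bar>c v (z k)\<bar> \<le> ?b" if "v \<in> S" for v k
    by (rule abs_cost_le_cost_bound[OF S(3) cost_cont that])
  have lip: "\<bar>c (?w p) (z k) - c (?w q) (z k)\<bar> \<le> K * norm (p - q)"
    if "p \<in> prob_simplex" "q \<in> prob_simplex" for p q k
    using component_le_norm_cart[of "cost_vec c z (?w p) - cost_vec c z (?w q)" k]
      cost_vec_w_opt_lipschitz[OF S N c_convex c_lipschitz \<phi>(2,3) \<rho> that]
    by (simp add: K_def cost_vec_def)
  \<comment> \<open>Used twice: for measurability of the losses and for limits along the dense
    subclass.\<close>
  have cost_w_cont: "continuous_on prob_simplex (\<lambda>p. c (?w p) (z k))" for k
    using lip K by (intro lipschitz_on_continuous_on[where L = K] lipschitz_onI)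
      (auto simp: dist_real_def dist_norm)
  have H_borel: "f \<in> borel_measurable ?Y" if "f \<in> H" for f
    using H_measurable that by (auto simp: pointwise_measurable_class_def)
  have loss_meas: "loss f \<in> borel_measurable D" if f: "f \<in> H" for f
  proof -
    \<comment> \<open>The composed cost is known to be continuous only on the simplex, so
      \<open>f\<close> is regarded as a map into the simplex.\<close>
    have "f \<in> measurable ?Y (restrict_space borel prob_simplex)"
      using H_borel[OF f] H_simplex[OF f] by (intro measurable_restrict_space2) (auto simp: space_Y)
    then have "(\<lambda>x. c (?w (f x)) (z k)) \<in> borel_measurable ?Y" for k
      by (rule measurable_compose[OF _ borel_measurable_continuous_on_restrict[OF cost_w_cont]])
    then have "(\<lambda>(x, \<xi>). c (?w (f x)) \<xi>) \<in> borel_measurable (?Y \<Otimes>\<^sub>M count_space (range z))"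
      by (intro borel_measurable_pair_count_space z)
    then show ?thesis
      unfolding measurable_cong_sets[OF D(2) refl] loss_def by (simp add: case_prod_beta)
  qed
  have loss_bound: "\<bar>loss f s\<bar> \<le> ?b" and loss_nonneg: "0 \<le> loss f s" if "s \<in> space D" for f s
    using that cost_le[OF w_in] c_nonneg[OF w_in] by (auto simp: loss_def space_D)
  obtain H\<^sub>0 where H\<^sub>0: "H\<^sub>0 \<subseteq> H" "countable H\<^sub>0"
    and dense: "\<And>f. f \<in> H \<Longrightarrow> \<exists>h. range h \<subseteq> H\<^sub>0 \<and> (\<forall>x\<in>space ?Y. (\<lambda>j. h j x) \<longlonglongrightarrow> f x)"
    using H_measurable by (auto simp: pointwise_measurable_class_def)
  have H\<^sub>0_ne: "H\<^sub>0 \<noteq> {}" using False dense by blast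
  interpret lipschitz_loss_class D H\<^sub>0 ?Y fst loss "\<lambda>f. f" ?b K
  proof
    show "fst \<in> measurable D ?Y"
      unfolding measurable_cong_sets[OF D(2) refl] by (rule measurable_fst)
    show "\<bar>f y $ k\<bar> \<le> 1" if "f \<in> H\<^sub>0" "y \<in> space ?Y" for f y k
      using that H_simplex[of f y] H\<^sub>0(1) by (intro prob_simplex_component_le) (auto simp: space_Y)
    show "\<bar>loss f s - loss f' s\<bar> \<le> K * norm (f (fst s) - f' (fst s))"
      if "f \<in> H\<^sub>0" "f' \<in> H\<^sub>0" "s \<in> space D" for f f' s
      using that H\<^sub>0(1) by (auto simp: loss_def space_D intro!: lip H_simplex)
  qed (use H\<^sub>0 H\<^sub>0_ne loss_meas loss_bound H_borel K in auto)
  have risk_eq: "risk D c (?w \<circ> f) = D.expectation (loss f)" for f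
  proof -
    have "(\<lambda>(x, \<xi>). c ((?w \<circ> f) x) \<xi>) = loss f" by (auto simp: loss_def)
    then show ?thesis by (simp add: risk_def)
  qed
  have emp_eq: "empirical_risk n s c (?w \<circ> f) = 1 / real n * (\<Sum>i<n. loss f (s i))" for s f
    by (simp add: empirical_risk_def loss_def)
  let ?R = "sqrt 2 * L\<^sub>c\<^sup>2 / \<rho> * rademacher Dx n H + ?b * sqrt (ln (1 / \<delta>) / (2 * real n))"
  let ?good = "\<lambda>s f. risk D c (?w \<circ> f) \<le> empirical_risk n s c (?w \<circ> f) + ?R"
  \<comment> \<open>Equality of the events matters, not just an inclusion: a set that is not
    measurable has measure 0 by default. Countability gives measurability for
    \<open>H\<^sub>0\<close>; dominated convergence for the risk and pointwise limits for the
    empirical risk carry the bound back to \<open>H\<close>.\<close>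
  have closure: "(\<forall>f\<in>H. ?good s f) \<longleftrightarrow> (\<forall>f\<in>H\<^sub>0. ?good s f)" if s: "s \<in> space (PiM {..<n} (\<lambda>_. D))" for s
  proof
    assume good: "\<forall>f\<in>H\<^sub>0. ?good s f"
    show "\<forall>f\<in>H. ?good s f"
    proof
      fix f assume f: "f \<in> H"
      obtain h where h: "range h \<subseteq> H\<^sub>0" "\<And>x. x \<in> X \<Longrightarrow> (\<lambda>j. h j x) \<longlonglongrightarrow> f x"
        using dense[OF f] by (auto simp: space_Y)
      have hH: "h j \<in> H" for j using h(1) H\<^sub>0(1) by auto
      have lim: "(\<lambda>j. loss (h j) t) \<longlonglongrightarrow> loss f t" if t: "t \<in> space D" for t
      proof -
        obtain x k where xk: "t = (x, z k)" "x \<in> X" using t by (auto simp: space_D)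
        have "(\<lambda>j. (\<lambda>p. c (?w p) (z k)) (h j x)) \<longlonglongrightarrow> (\<lambda>p. c (?w p) (z k)) (f x)"
          by (rule continuous_on_tendsto_compose[OF cost_w_cont h(2)[OF xk(2)] H_simplex[OF f xk(2)]])
            (simp add: H_simplex[OF hH xk(2)])
        then show ?thesis by (simp add: loss_def xk)
      qed
      have lim_risk: "(\<lambda>j. D.expectation (loss (h j))) \<longlonglongrightarrow> D.expectation (loss f)"
      proof (rule integral_dominated_convergence[where w = "\<lambda>_. ?b"])
        show "AE t in D. (\<lambda>j. loss (h j) t) \<longlonglongrightarrow> loss f t" using lim by (rule AE_I2)
        show "AE t in D. norm (loss (h j) t) \<le> ?b" for j
          using loss_bound by (intro AE_I2) simp
      qed (simp_all add: loss_meas f hH)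
      have lim_emp: "(\<lambda>j. 1 / real n * (\<Sum>i<n. loss (h j) (s i)) + ?R)
          \<longlonglongrightarrow> 1 / real n * (\<Sum>i<n. loss f (s i)) + ?R"
        by (intro tendsto_intros lim space_PiM_D[OF s]) simp
      have "D.expectation (loss (h j)) \<le> 1 / real n * (\<Sum>i<n. loss (h j) (s i)) + ?R" for j
        using good h(1) unfolding risk_eq emp_eq by blast
      then show "?good s f"
        unfolding risk_eq emp_eq by (intro LIMSEQ_le[OF lim_risk lim_emp]) simp
    qed
  qed (use H\<^sub>0(1) in auto)
  let ?\<epsilon> = "real n * ?b * sqrt (ln (1 / \<delta>) / (2 * real n))"
  let ?bad = "\<lambda>s. (\<integral>s. dev_sup n (\<lambda>_. 0) s \<partial>PiM {..<n} (\<lambda>_. D)) + ?\<epsilon> < dev_sup n (\<lambda>_. 0) s"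
  have mean: "(\<integral>s. dev_sup n (\<lambda>_. 0) s \<partial>PiM {..<n} (\<lambda>_. D)) \<le> real n * (sqrt 2 * K) * rademacher Dx n H"
    unfolding Dx
    using H\<^sub>0(1) H_simplex H_rademacher n
    by (intro expectation_dev_sup_le_rademacher prob_simplex_component_le)
      (auto simp: space_Y Dx)
  have good: "\<forall>f\<in>H\<^sub>0. ?good s f" if s: "s \<in> space (PiM {..<n} (\<lambda>_. D))" and "\<not> ?bad s" for s
  proof
    fix f assume "f \<in> H\<^sub>0"
    then have "(\<Sum>i<n. D.expectation (loss f) - loss f (s i)) \<le> dev_sup n (\<lambda>_. 0) s"
      using s by (rule dev_sup_ge)
    also have "\<dots> \<le> real n * (sqrt 2 * K) * rademacher Dx n H + ?\<epsilon>"
      using mean that(2) by linarith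
    also have "\<dots> = real n * ?R" by (simp add: K_def algebra_simps)
    finally have "real n * D.expectation (loss f) \<le> (\<Sum>i<n. loss f (s i)) + real n * ?R"
      by (simp add: sum_subtractf)
    then show "?good s f" unfolding risk_eq emp_eq using n by (simp add: field_simps)
  qed
  have dev_meas: "dev_sup n (\<lambda>_. 0) \<in> borel_measurable (PiM {..<n} (\<lambda>_. D))"
    using integrable_dev_sup[of "\<lambda>_. 0" 0 n] by (intro borel_measurable_integrable) auto
  have "1 - \<delta> \<le> 1 - \<P>(s in PiM {..<n} (\<lambda>_. D). ?bad s)"
    using dev_sup_tail[OF loss_nonneg n \<delta>] by simp
  also have "\<dots> = \<P>(s in PiM {..<n} (\<lambda>_. D). \<not> ?bad s)"
    using dev_meas by (intro Dn.prob_neg[symmetric]) measurable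
  also have "\<dots> \<le> \<P>(s in PiM {..<n} (\<lambda>_. D). \<forall>f\<in>H\<^sub>0. ?good s f)"
  proof (rule Dn.finite_measure_mono)
    show "{s \<in> space (PiM {..<n} (\<lambda>_. D)). \<forall>f\<in>H\<^sub>0. ?good s f} \<in> Dn.events"
    proof (rule sets.sets_Collect_countable_All'[OF _ H\<^sub>0(2)])
      fix f assume "f \<in> H\<^sub>0"
      then have "loss f \<in> borel_measurable D" using H\<^sub>0(1) loss_meas by blast
      from borel_measurable_PiM_component[OF this] have "(\<lambda>s. 1 / real n * (\<Sum>i<n. loss f (s i)) + ?R) \<in> borel_measurable (PiM {..<n} (\<lambda>_. D))"
        by (intro borel_measurable_add borel_measurable_times borel_measurable_sum
            borel_measurable_const) auto
      then show "{s \<in> space (PiM {..<n} (\<lambda>_. D)). ?good s f} \<in> Dn.events"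
        unfolding risk_eq emp_eq by (intro borel_measurable_le borel_measurable_const)
    qed
  qed (use good in auto)
  also have "{s \<in> space (PiM {..<n} (\<lambda>_. D)). \<forall>f\<in>H\<^sub>0. ?good s f}
      = {s \<in> space (PiM {..<n} (\<lambda>_. D)). \<forall>f\<in>H. ?good s f}"
    using closure by auto
  finally show ?thesis by (simp add: iid_def add.assoc)
qed

end
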